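(* Consider the stochastic-approximation algorithm $x_{k+1}=\operatorname{prox}_{1/L}\{x_k-\tfrac1L(\nabla f(x_k)+e_k)\}$ for $f(x)=\mathbf E F(x,Z)$ with sampled search direction $$\nabla f(x_k)+e_k=\frac1{m_k}\sum_{i=1}^{m_k}\nabla_xF(x_k,Z_i),$$ as described in the context, where $\frac1{m_k}\le\lambda\beta^k$ for all $k$, for some $\beta\in(0,1)$ and $\lambda>0$. Then the following hold. (1) [Expectation bound] If the variance of the error is bounded, i.e., $\sup_x\mathbf E\|\nabla f(x)-\nabla_x F(x,Z)\|^2<\infty$, then $$\mathbf E\pi_k-\rho^k\pi_0=O\big([\max\{\beta,\rho\}+\zeta]^k\big)\quad\text{for all }\zeta>0.$$ If $\rho\ne\beta$, then the bound holds with $\zeta=0$. (2) [Tail bound] If the diameter of the error is bounded, i.e., $$\sup_x\Big\{\sup_{z\in\Omega}[\nabla_x F(x,z)]_i-\inf_{z\in\Omega}[\nabla_x F(x,z)]_i\Big\}<\infty$$ for all $i=1,\dots,n$, where $\Omega$ is the sample space, then $$\Pr(\pi_k-\rho^k\pi_0\ge\epsilon)=O\left(\exp\left[-\frac{\epsilon}{\max\{\beta,\rho\}^k}\cdot\zeta\right]\right)\quad\text{for some }\zeta>0.$$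
   Context: Setting. $f:\mathbb R^n\to\mathbb R$ is differentiable, $g:\mathbb R^n\to(-\infty,+\infty]$ is convex and lower semicontinuous, $h:=f+g$, and the solution set $\mathcal S:=\arg\min h$ is nonempty. $\|\cdot\|$ is the Euclidean norm. For $\alpha>0$, $\operatorname{prox}_\alpha\{z\}:=\arg\min_y\{\alpha g(y)+\tfrac12\|z-y\|^2\}$. There are constants $L>0$ and $\tau\ge 1$ such that for all $x,y\in\mathbb R^n$: $\|\nabla f(y)-\nabla f(x)\|\le L\|y-x\|$, and $\min_{\bar x\in\mathcal S}\|x-\bar x\|\le\tau\,\|x-\operatorname{prox}_{1/L}\{x-\tfrac1L\nabla f(x)\}\|$. Here $f(x)=\mathbf E F(x,Z)$ where $Z$ is a random variable, and $\nabla_xF$ is the gradient of $F$ in its first argument. At each iteration $k$ a random sample $Z_1,\dots,Z_{m_k}$ of size $m_k$ is generated, consisting of independent copies of $Z$; $e_k$ is the resulting gradient error. $[z]_i$ denotes the $i$th component of a vector $z$. The optimality gap is $\pi_k:=h(x_k)-\inf h$. Constant: $\rho:=\frac{40\tau^2}{1+40\tau^2}$. *)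

theory Defs
  imports "HOL-Probability.Probability" "HOL-Library.Landau_Symbols"
begin

definition convex_ereal :: "('a::real_vector \<Rightarrow> ereal) \<Rightarrow> bool" where
  "convex_ereal g \<longleftrightarrow>
     (\<forall>x y. \<forall>t\<in>{0..1::real}.
        g ((1 - t) *\<^sub>R x + t *\<^sub>R y) \<le> ereal (1 - t) * g x + ereal t * g y)"

definition lower_semicont :: "('a::topological_space \<Rightarrow> ereal) \<Rightarrow> bool" where
  "lower_semicont g \<longleftrightarrow> (\<forall>x. g x \<le> Liminf (at x) g)"

definition argmin_set :: "('a \<Rightarrow> ereal) \<Rightarrow> 'a set" where
  "argmin_set h = {x. is_arg_min h (\<lambda>_. True) x}"

text \<open>
  The unique minimiser when \<^term>\<open>g\<close> is convex, lower semicontinuous, never \<open>-\<infinity>\<close> and not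
  identically \<open>\<infinity>\<close>, and \<^term>\<open>\<alpha> > 0\<close>; unspecified if there is no minimiser.
\<close>
definition prox :: "('a::real_normed_vector \<Rightarrow> ereal) \<Rightarrow> real \<Rightarrow> 'a \<Rightarrow> 'a" where
  "prox g \<alpha> z = (ARG_MIN (\<lambda>y. ereal \<alpha> * g y + ereal ((norm (z - y))\<^sup>2 / 2)) y. True)"

text \<open>
  Real-valued, hence only meaningful where \<^term>\<open>h x\<close> and \<^term>\<open>INF y. h y\<close> are both finite
  (\<^const>\<open>real_of_ereal\<close> sends infinite values to \<open>0\<close>).
\<close>
definition opt_gap :: "('a \<Rightarrow> ereal) \<Rightarrow> 'a \<Rightarrow> real" where
  "opt_gap h x = real_of_ereal (h x - (INF y. h y))"

end

theory Submission
  imports Defs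
begin

text \<open>
  Comparing a proximal gradient step with perturbed gradient to a point of \<open>\<S>\<close> nearest to
  \<open>x\<^sub>k\<close> and to \<open>x\<^sub>k\<close> itself, and using the error bound, gives
  \<open>\<pi>\<^sub>k\<^sub>+\<^sub>1 \<le> r \<pi>\<^sub>k + (2 / L) \<parallel>e\<^sub>k\<parallel>\<^sup>2\<close> with \<open>r = 8 \<tau>\<^sup>2 / (1 + 8 \<tau>\<^sup>2)\<close>.
  This \<open>r\<close> is strictly smaller than \<open>\<rho>\<close>, hence than \<open>\<gamma> = max \<beta> \<rho>\<close>, so the case \<open>\<rho> = \<beta>\<close> needs no
  special treatment. Since \<open>x\<^sub>k\<close> is independent of the samples of step \<open>k\<close>, the error behaves like
  that of an average of \<open>m\<^sub>k\<close> independent centred vectors at a fixed point: its mean square is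
  \<open>O(1 / m\<^sub>k)\<close>, and in the bounded case Hoeffding's inequality applies. The expectation bound follows
  by summing a geometric convolution. For the tail, a large weighted sum of the \<open>\<parallel>e\<^sub>j\<parallel>\<^sup>2\<close> forces
  one summand to exceed its share under a geometric splitting with ratio \<open>sqrt (r / \<gamma>)\<close>, and a union
  bound suffices.

  That the sampled gradient is unbiased is not assumed. Differentiation under the expectation is
  justified by bounding the difference quotients in mean square along segments.
\<close>

subsection \<open>Differentiable functions with Lipschitz gradient\<close>

lemma GDERIV_line:
  fixes f :: "'a::real_inner \<Rightarrow> real"
  assumes "GDERIV f (u + t *\<^sub>R v) :> D"
  shows "((\<lambda>s. f (u + s *\<^sub>R v)) has_real_derivative v \<bullet> D) (at t within T)"
proof -
  have f: "(f has_derivative (\<lambda>h. h \<bullet> D)) (at (u + t *\<^sub>R v))"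
    using assms by (simp add: gderiv_def)
  have l: "((\<lambda>s. u + s *\<^sub>R v) has_derivative (\<lambda>s. s *\<^sub>R v)) (at t within T)"
    by (auto intro!: derivative_eq_intros)
  have "((\<lambda>s. f (u + s *\<^sub>R v)) has_derivative (\<lambda>s. (s *\<^sub>R v) \<bullet> D)) (at t within T)"
    by (rule has_derivative_compose[OF l f])
  then show ?thesis
    by (simp add: has_field_derivative_def mult.commute[of _ "v \<bullet> D"])
qed

lemma GDERIV_isCont:
  fixes f :: "'a::real_inner \<Rightarrow> real"
  shows "GDERIV f u :> D \<Longrightarrow> isCont f u"
  unfolding gderiv_def by (rule has_derivative_continuous)

text \<open>The descent lemma. Along the segment from \<open>x\<close> to \<open>y\<close>,
  subtracting the linear and quadratic terms from \<open>f\<close> leaves a function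
  \<open>\<phi>\<close> whose derivative is nonpositive by Cauchy-Schwarz and the Lipschitz
  condition.\<close>

lemma lipschitz_gradient_upper_bound:
  fixes f :: "'a::real_inner \<Rightarrow> real"
  assumes f: "\<And>u. GDERIV f u :> gradf u"
    and lip: "\<And>u v. norm (gradf v - gradf u) \<le> L * norm (v - u)"
  shows "f y \<le> f x + (y - x) \<bullet> gradf x + L / 2 * (norm (y - x))\<^sup>2"
proof -
  define v where "v = y - x"
  define \<phi> where "\<phi> s = f (x + s *\<^sub>R v) - s * (v \<bullet> gradf x) - L / 2 * s\<^sup>2 * (norm v)\<^sup>2" for s
  have "\<phi> 1 \<le> \<phi> 0"
  proof (rule DERIV_nonpos_imp_nonincreasing[of 0 1 \<phi>])
    fix s :: real assume s: "0 \<le> s" "s \<le> 1"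
    have d: "(\<phi> has_real_derivative
        v \<bullet> gradf (x + s *\<^sub>R v) - v \<bullet> gradf x - L * s * (norm v)\<^sup>2) (at s)"
      unfolding \<phi>_def
      by (auto intro!: derivative_eq_intros GDERIV_line[OF f] simp: power2_eq_square algebra_simps)
    have "v \<bullet> gradf (x + s *\<^sub>R v) - v \<bullet> gradf x = v \<bullet> (gradf (x + s *\<^sub>R v) - gradf x)"
      by (simp add: inner_diff_right)
    also have "\<dots> \<le> norm v * norm (gradf (x + s *\<^sub>R v) - gradf x)"
      by (rule norm_cauchy_schwarz)
    also have "\<dots> \<le> norm v * (L * norm (x + s *\<^sub>R v - x))"
      by (rule mult_left_mono[OF lip]) simp
    also have "\<dots> = L * s * (norm v)\<^sup>2"
      using s by (simp add: power2_eq_square)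
    finally show "\<exists>y. (\<phi> has_real_derivative y) (at s) \<and> y \<le> 0"
      using d by (intro exI[of _ "v \<bullet> gradf (x + s *\<^sub>R v) - v \<bullet> gradf x - L * s * (norm v)\<^sup>2"]) simp
  qed simp
  then show ?thesis
    by (simp add: \<phi>_def v_def)
qed

lemma lipschitz_gradient_lower_bound:
  fixes f :: "'a::real_inner \<Rightarrow> real"
  assumes f: "\<And>u. GDERIV f u :> gradf u"
    and lip: "\<And>u v. norm (gradf v - gradf u) \<le> L * norm (v - u)"
  shows "f x + (y - x) \<bullet> gradf x \<le> f y + L / 2 * (norm (y - x))\<^sup>2"
proof -
  have "- f y \<le> - f x + (y - x) \<bullet> (- gradf x) + L / 2 * (norm (y - x))\<^sup>2"
  proof (rule lipschitz_gradient_upper_bound)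
    show "GDERIV (\<lambda>u. - f u) u :> - gradf u" for u
      by (rule GDERIV_minus[OF f])
    show "norm (- gradf v - - gradf u) \<le> L * norm (v - u)" for u v
      using lip[of v u] by (simp add: norm_minus_commute)
  qed
  then show ?thesis by simp
qed

subsection \<open>Lower semicontinuous functions and the proximal map\<close>

text \<open>The threshold varies continuously instead of being constant, so that superlevel sets of
  \<open>g\<close> plus a continuous function reduce to this form.\<close>

lemma lower_semicont_open_above:
  assumes g: "lower_semicont g" and r: "\<And>y. isCont r y"
  shows "open {y. ereal (r y) < g y}"
proof -
  have o: "open {y. c < g y}" for c
  proof (subst open_subopen, safe)
    fix y assume "c < g y"
    moreover have "g y \<le> Liminf (at y) g"
      using g by (simp add: lower_semicont_def)
    ultimately have "eventually (\<lambda>z. c < g z) (at y)"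
      by (intro less_LiminfD) (rule less_le_trans)
    then obtain T where "open T" "y \<in> T" "\<And>z. z \<in> T \<Longrightarrow> z \<noteq> y \<Longrightarrow> c < g z"
      unfolding eventually_at_topological by blast
    with \<open>c < g y\<close> show "\<exists>T. open T \<and> y \<in> T \<and> T \<subseteq> {y. c < g y}"
      by (intro exI[of _ T]) blast
  qed
  \<comment> \<open>A real number \<open>d\<close> strictly between \<open>r y\<close> and
    \<open>g y\<close> decouples the two conditions.\<close>
  have "{y. ereal (r y) < g y} = (\<Union>d. {y. r y < d} \<inter> {y. ereal d < g y})"
  proof (intro set_eqI iffI)
    fix y assume "y \<in> {y. ereal (r y) < g y}"
    then obtain z where "ereal (r y) < z" "z < g y"
      using dense by blast
    then show "y \<in> (\<Union>d. {y. r y < d} \<inter> {y. ereal d < g y})"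
      by (cases z) auto
  qed (auto intro: less_trans simp flip: ereal_less_eq(3) less_ereal.simps(1))
  moreover have "open {y. r y < d}" for d
    by (intro open_Collect_less) (auto intro: continuous_at_imp_continuous_on r)
  ultimately show ?thesis
    using o by (auto intro!: open_UN open_Int)
qed

text \<open>Without a minimiser the strict superlevel sets of points of \<open>K\<close> cover
  \<open>K\<close>; in a finite subcover the centre of least value is covered by no member.\<close>

lemma compact_attains_min:
  fixes \<phi> :: "'a::topological_space \<Rightarrow> 'b::linorder"
  assumes K: "compact K" "K \<noteq> {}" and o: "\<And>w. w \<in> K \<Longrightarrow> open {y. \<phi> w < \<phi> y}"
  shows "\<exists>w\<in>K. \<forall>y\<in>K. \<phi> w \<le> \<phi> y"
proof (rule ccontr)
  assume "\<not> ?thesis"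
  then have "K \<subseteq> (\<Union>w\<in>K. {y. \<phi> w < \<phi> y})"
    by (force simp: not_le)
  with K(1) o obtain D where D: "D \<subseteq> K" "finite D" "K \<subseteq> (\<Union>w\<in>D. {y. \<phi> w < \<phi> y})"
    by (rule compactE_image)
  with K(2) have "D \<noteq> {}" by auto
  with D(2) have "Min (\<phi> ` D) \<in> \<phi> ` D" by (intro Min_in) auto
  then obtain w where w: "w \<in> D" "\<phi> w = Min (\<phi> ` D)" by auto
  with D(1,3) obtain v where "v \<in> D" "\<phi> v < \<phi> w" by blast
  moreover from this have "\<phi> w \<le> \<phi> v"
    using D(2) w(2) by simp
  ultimately show False by simp
qed

text \<open>The affine minorant lets the quadratic term dominate, so the sublevel set through
  \<open>z0\<close> is bounded; lower semicontinuity makes it closed, hence compact. Existence of a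
  minimiser suffices because \<open>prox\<close> selects one by choice.\<close>

lemma prox_is_arg_min:
  fixes g :: "'a::euclidean_space \<Rightarrow> ereal"
  assumes lsc: "lower_semicont g" and proper: "\<And>u. g u \<noteq> -\<infinity>" and dom: "g z0 < \<infinity>"
    and minorant: "\<And>y. ereal (a + y \<bullet> b) \<le> g y" and \<alpha>: "0 < \<alpha>"
  shows "is_arg_min (\<lambda>y. ereal \<alpha> * g y + ereal ((norm (z - y))\<^sup>2 / 2)) (\<lambda>_. True) (prox g \<alpha> z)"
proof -
  define \<phi> where "\<phi> y = ereal \<alpha> * g y + ereal ((norm (z - y))\<^sup>2 / 2)" for y
  have o: "open {y. c < \<phi> y}" if "c \<noteq> \<infinity>" for c
  proof (cases c)
    case (real r)
    have "(c < \<phi> y) = (ereal ((r - (norm (z - y))\<^sup>2 / 2) / \<alpha>) < g y)" for y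
      unfolding \<phi>_def real using proper[of y] \<alpha>
      by (cases "g y") (auto simp: field_simps)
    moreover have "isCont (\<lambda>y. (r - (norm (z - y))\<^sup>2 / 2) / \<alpha>) y" for y
      by (intro continuous_intros) (use \<alpha> in auto)
    ultimately show ?thesis
      using lower_semicont_open_above[OF lsc] by simp
  next
    case MInf
    have "\<phi> y > -\<infinity>" for y
      unfolding \<phi>_def using proper[of y] \<alpha> by (cases "g y") auto
    then show ?thesis by (simp add: MInf)
  qed (use that in auto)
  have fin: "\<phi> z0 \<noteq> \<infinity>"
    unfolding \<phi>_def using proper[of z0] dom by (cases "g z0") auto
  define K where "K = {y. \<phi> y \<le> \<phi> z0}"
  have "K = - {y. \<phi> z0 < \<phi> y}"
    by (auto simp: K_def)
  then have "closed K"
    using o[OF fin] by (simp add: closed_def)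
  moreover have "bounded K"
  proof -
    obtain c where c: "\<phi> z0 = ereal c"
      unfolding \<phi>_def using proper[of z0] dom by (cases "g z0") auto
    \<comment> \<open>\<open>A\<close> and \<open>B\<close> come from expanding the minorant around
      \<open>z\<close>: with n the norm of \<open>y - z\<close> they give n^2 / 2 \<le> A + B n,
      which bounds n.\<close>
    define A where "A = c - \<alpha> * a - \<alpha> * (z \<bullet> b)"
    define B where "B = \<alpha> * norm b"
    have "norm (y - z) \<le> 2 * B + \<bar>A\<bar> + 1" if "y \<in> K" for y
    proof -
      have "\<phi> y \<le> ereal c"
        using that c by (simp add: K_def)
      moreover have "ereal (\<alpha> * (a + y \<bullet> b) + (norm (z - y))\<^sup>2 / 2) \<le> \<phi> y"
        unfolding \<phi>_def using minorant[of y] \<alpha> by (cases "g y") auto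
      ultimately have "ereal (\<alpha> * (a + y \<bullet> b) + (norm (z - y))\<^sup>2 / 2) \<le> ereal c"
        by (rule order_trans[rotated])
      then have le: "\<alpha> * (a + y \<bullet> b) + (norm (z - y))\<^sup>2 / 2 \<le> c" by simp
      have "- (norm (y - z) * norm b) \<le> (y - z) \<bullet> b"
        using Cauchy_Schwarz_ineq2[of "y - z" b] by simp
      then have "- (B * norm (y - z)) \<le> \<alpha> * ((y - z) \<bullet> b)"
        using \<alpha> mult_left_mono[of "- (norm (y - z) * norm b)" "(y - z) \<bullet> b" \<alpha>]
        by (simp add: B_def mult_ac)
      with le have quad: "(norm (y - z))\<^sup>2 / 2 \<le> A + B * norm (y - z)"
        by (simp add: A_def norm_minus_commute inner_diff_left algebra_simps)
      have B: "B \<ge> 0" using \<alpha> by (simp add: B_def)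
      define n where "n = norm (y - z)"
      show ?thesis unfolding n_def[symmetric]
      proof (rule ccontr)
        assume n: "\<not> n \<le> 2 * B + \<bar>A\<bar> + 1"
        have "n * (2 * B + \<bar>A\<bar> + 1) < n * n"
          by (rule mult_strict_left_mono) (use n B in auto)
        moreover have "n * n \<le> 2 * A + 2 * B * n"
          using quad by (simp add: n_def power2_eq_square)
        moreover have "\<bar>A\<bar> \<le> n * \<bar>A\<bar>"
          using n B mult_right_mono[of 1 n "\<bar>A\<bar>"] by auto
        moreover have "\<bar>A\<bar> < n" using n B by auto
        ultimately show False
          by (simp add: algebra_simps)
      qed
    qed
    then have "K \<subseteq> cball z (2 * B + \<bar>A\<bar> + 1)"
      by (auto simp: dist_norm norm_minus_commute)
    then show ?thesis
      by (rule bounded_subset[OF bounded_cball])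
  qed
  ultimately have "compact K"
    by (simp add: compact_eq_bounded_closed)
  moreover have "z0 \<in> K" by (simp add: K_def)
  moreover have "open {y. \<phi> w < \<phi> y}" if "w \<in> K" for w
    using that fin by (intro o) (auto simp: K_def)
  ultimately obtain w where w: "w \<in> K" "\<forall>y\<in>K. \<phi> w \<le> \<phi> y"
    using compact_attains_min[of K \<phi>] by auto
  then have "is_arg_min \<phi> (\<lambda>_. True) w"
    unfolding is_arg_min_def K_def by (auto simp: not_less) (meson less_le_trans less_le_not_le linorder_not_le order_trans)
  then have "is_arg_min \<phi> (\<lambda>_. True) (arg_min \<phi> (\<lambda>_. True))"
    unfolding arg_min_def by (rule someI)
  then show ?thesis
    by (simp add: prox_def \<phi>_def[abs_def])
qed

text \<open>The limit t -> 0 in comparisons of a minimiser with points of a segment: after division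
  by t only the first-order term survives.\<close>

lemma nonneg_if_le_small_multiple:
  fixes a b :: real
  assumes "\<And>t. 0 < t \<Longrightarrow> t \<le> 1 \<Longrightarrow> 0 \<le> a + t * b"
  shows "0 \<le> a"
proof (rule ccontr)
  assume "\<not> 0 \<le> a"
  \<comment> \<open>For negative \<open>a\<close> this choice keeps \<open>t * b\<close> at most
    \<open>- a / 2\<close>, which makes \<open>a + t * b\<close> negative.\<close>
  define t where "t = min 1 (- a / (2 * (\<bar>b\<bar> + 1)))"
  have t: "0 < t" "t \<le> 1" using \<open>\<not> 0 \<le> a\<close> by (auto simp: t_def field_simps)
  have "t * b \<le> t * (\<bar>b\<bar> + 1)" using t by (intro mult_left_mono) auto
  also have "\<dots> \<le> - a / (2 * (\<bar>b\<bar> + 1)) * (\<bar>b\<bar> + 1)"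
    by (rule mult_right_mono) (auto simp: t_def)
  also have "\<dots> = - a / 2" by (simp add: field_simps)
  finally show False using assms[OF t] \<open>\<not> 0 \<le> a\<close> by simp
qed

section \<open>Composite problems: minimisers, first-order optimality and the proximal map\<close>

locale composite_problem =
  fixes f :: "'a::euclidean_space \<Rightarrow> real" and gradf :: "'a \<Rightarrow> 'a"
    and g h :: "'a \<Rightarrow> ereal" and L :: real
  assumes gradf: "\<And>u. GDERIV f u :> gradf u"
    and g_proper: "\<And>u. g u \<noteq> -\<infinity>"
    and g_convex: "convex_ereal g"
    and g_lsc: "lower_semicont g"
    and h: "h = (\<lambda>u. ereal (f u) + g u)"
    and S_nonempty: "argmin_set h \<noteq> {}"
    and L_pos: "L > 0"
    and lipschitz: "\<And>u v. norm (gradf v - gradf u) \<le> L * norm (v - u)"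
    and h_dom: "\<exists>u. h u < \<infinity>"
begin

text \<open>A stand-in for \<open>g\<close> in real arithmetic; \<open>real_of_ereal\<close> sends
  infinity to 0, so it is faithful only where \<open>g\<close> is finite.\<close>

definition gr :: "'a \<Rightarrow> real" where
  "gr u = real_of_ereal (g u)"

definition hmin :: real where
  "hmin = real_of_ereal (INF y. h y)"

lemma g_eq: "g u < \<infinity> \<Longrightarrow> g u = ereal (gr u)"
  using g_proper[of u] by (cases "g u") (auto simp: gr_def)

lemma h_eq: "g u < \<infinity> \<Longrightarrow> h u = ereal (f u + gr u)"
  by (simp add: h g_eq)

lemma g_finite_if_h_finite: "h u < \<infinity> \<Longrightarrow> g u < \<infinity>"
  by (cases "g u") (auto simp: h)

lemma g_segment:
  assumes "g u < \<infinity>" "g v < \<infinity>" "0 \<le> t" "t \<le> 1"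
  shows "g (u + t *\<^sub>R (v - u)) < \<infinity>" "gr (u + t *\<^sub>R (v - u)) \<le> gr u + t * (gr v - gr u)"
proof -
  have "(1 - t) *\<^sub>R u + t *\<^sub>R v = u + t *\<^sub>R (v - u)"
    by (simp add: algebra_simps)
  moreover have "g ((1 - t) *\<^sub>R u + t *\<^sub>R v) \<le> ereal (1 - t) * g u + ereal t * g v"
    using g_convex assms by (simp add: convex_ereal_def)
  moreover have "ereal (1 - t) * g u + ereal t * g v = ereal (gr u + t * (gr v - gr u))"
    using assms by (simp add: g_eq algebra_simps)
  ultimately have le: "g (u + t *\<^sub>R (v - u)) \<le> ereal (gr u + t * (gr v - gr u))"
    by simp
  then show fin: "g (u + t *\<^sub>R (v - u)) < \<infinity>"
    by (rule le_less_trans) simp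
  show "gr (u + t *\<^sub>R (v - u)) \<le> gr u + t * (gr v - gr u)"
    using le unfolding g_eq[OF fin] by simp
qed

lemma minimizer:
  assumes "s \<in> argmin_set h"
  shows "g s < \<infinity>" "f s + gr s = hmin" "(INF y. h y) = ereal hmin"
proof -
  have le: "h s \<le> h y" for y
    using assms by (auto simp: argmin_set_def is_arg_min_def not_less)
  \<comment> \<open>\<open>h_dom\<close> excludes the degenerate case of \<open>h\<close> constantly
    infinite, in which every point is a minimiser.\<close>
  show g: "g s < \<infinity>"
    using h_dom le by (meson g_finite_if_h_finite le_less_trans)
  have "(INF y. h y) = h s"
    by (intro antisym INF_lower INF_greatest le) simp
  then show "f s + gr s = hmin" "(INF y. h y) = ereal hmin"
    using g by (simp_all add: hmin_def h_eq)
qed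

lemma INF_h: "(INF y. h y) = ereal hmin"
  using S_nonempty minimizer(3) by blast

lemma hmin_le: "g u < \<infinity> \<Longrightarrow> hmin \<le> f u + gr u"
  using INF_lower[of u UNIV h] by (simp add: INF_h h_eq)

lemma opt_gap_eq: "g u < \<infinity> \<Longrightarrow> opt_gap h u = f u + gr u - hmin"
  by (simp add: opt_gap_def INF_h h_eq)

lemma opt_gap_nonneg: "g u < \<infinity> \<Longrightarrow> 0 \<le> opt_gap h u"
  using hmin_le[of u] by (simp add: opt_gap_eq)

text \<open>The first-order optimality of a minimiser of \<^term>\<open>h\<close> yields an affine minorant of
  \<^term>\<open>g\<close>; no separation theorem is needed.\<close>
lemma g_affine_minorant: "\<exists>a b. \<forall>y. ereal (a + y \<bullet> b) \<le> g y"
proof -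
  obtain s where s: "s \<in> argmin_set h" using S_nonempty by blast
  note m = minimizer[OF s]
  have "gr s - (y - s) \<bullet> gradf s \<le> gr y" if y: "g y < \<infinity>" for y
  proof -
    \<comment> \<open>Minimality of \<open>s\<close> is tested at a point of the segment towards
      \<open>y\<close>; the quadratic remainder of \<open>f\<close> there is of second order in
      \<open>t\<close>.\<close>
    have "0 \<le> (gr y - gr s + (y - s) \<bullet> gradf s) + t * (L / 2 * (norm (y - s))\<^sup>2)"
      if t: "0 < t" "t \<le> 1" for t
    proof -
      let ?w = "s + t *\<^sub>R (y - s)"
      have "f s + gr s \<le> f ?w + gr ?w"
        using hmin_le[of ?w] g_segment[OF m(1) y, of t] t m(2) by simp
      also have "\<dots> \<le> (f s + (?w - s) \<bullet> gradf s + L / 2 * (norm (?w - s))\<^sup>2) + (gr s + t * (gr y - gr s))"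
        using lipschitz_gradient_upper_bound[OF gradf lipschitz, of ?w s]
          g_segment(2)[OF m(1) y, of t] t by simp
      also have "?w - s = t *\<^sub>R (y - s)" by simp
      finally have "0 \<le> t * (gr y - gr s + (y - s) \<bullet> gradf s + t * (L / 2 * (norm (y - s))\<^sup>2))"
        by (simp add: algebra_simps power2_eq_square del: scaleR_right_diff_distrib)
      then show ?thesis using t by (simp add: zero_le_mult_iff)
    qed
    from nonneg_if_le_small_multiple[OF this] show ?thesis by simp
  qed
  then have "ereal (gr s + s \<bullet> gradf s + y \<bullet> (- gradf s)) \<le> g y" for y
    by (cases "g y < \<infinity>") (auto simp: g_eq inner_diff_left algebra_simps)
  then show ?thesis by blast
qed

lemma prox_minimizes:
  "is_arg_min (\<lambda>y. ereal (1 / L) * g y + ereal ((norm (z - y))\<^sup>2 / 2)) (\<lambda>_. True) (prox g (1 / L) z)"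
proof -
  obtain u where "g u < \<infinity>" using h_dom g_finite_if_h_finite by blast
  moreover obtain a b where "\<And>y. ereal (a + y \<bullet> b) \<le> g y" using g_affine_minorant by blast
  ultimately show ?thesis
    using L_pos by (intro prox_is_arg_min[OF g_lsc g_proper]) auto
qed

lemma prox_dom: "g (prox g (1 / L) z) < \<infinity>"
proof -
  obtain u where u: "g u < \<infinity>" using h_dom g_finite_if_h_finite by blast
  let ?\<phi> = "\<lambda>y. ereal (1 / L) * g y + ereal ((norm (z - y))\<^sup>2 / 2)"
  have "?\<phi> (prox g (1 / L) z) \<le> ?\<phi> u"
    using prox_minimizes[of z] by (auto simp: is_arg_min_def not_less)
  also have "\<dots> < \<infinity>" by (simp add: g_eq[OF u])
  finally show ?thesis
    using L_pos by (cases "g (prox g (1 / L) z)") auto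
qed

text \<open>The optimality condition that \<open>L * (z - p)\<close> is a subgradient of
  \<open>g\<close> at \<open>p\<close>: compare the proximal objective at \<open>p\<close> and at
  \<open>p + t (y - p)\<close>, divide by t and let t tend to 0.\<close>

lemma prox_variational:
  fixes y z :: 'a
  assumes y: "g y < \<infinity>"
  defines "p \<equiv> prox g (1 / L) z"
  shows "gr p + L * ((y - p) \<bullet> (z - p)) \<le> gr y"
proof -
  have p: "g p < \<infinity>" unfolding p_def by (rule prox_dom)
  have "0 \<le> ((gr y - gr p) / L - (y - p) \<bullet> (z - p)) + t * ((norm (y - p))\<^sup>2 / 2)"
    if t: "0 < t" "t \<le> 1" for t
  proof -
    let ?w = "p + t *\<^sub>R (y - p)"
    note w = g_segment[OF p y, of t]
    have "ereal (1 / L) * g p + ereal ((norm (z - p))\<^sup>2 / 2)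
        \<le> ereal (1 / L) * g ?w + ereal ((norm (z - ?w))\<^sup>2 / 2)"
      using prox_minimizes[of z] by (auto simp: is_arg_min_def not_less p_def)
    then have "gr p / L + (norm (z - p))\<^sup>2 / 2 \<le> gr ?w / L + (norm (z - ?w))\<^sup>2 / 2"
      using w t by (simp add: g_eq[OF p] g_eq[OF w(1)])
    also have "\<dots> \<le> (gr p + t * (gr y - gr p)) / L + (norm (z - ?w))\<^sup>2 / 2"
      using w t L_pos by (simp add: divide_right_mono)
    also have "(norm (z - ?w))\<^sup>2 = (norm (z - p))\<^sup>2 - 2 * t * ((y - p) \<bullet> (z - p)) + t\<^sup>2 * (norm (y - p))\<^sup>2"
    proof -
      have "z - ?w = (z - p) - t *\<^sub>R (y - p)" by simp
      then show ?thesis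
        unfolding power2_norm_eq_inner
        by (simp add: inner_diff_left inner_diff_right inner_commute algebra_simps power2_eq_square)
    qed
    finally have "0 \<le> t * ((gr y - gr p) / L - (y - p) \<bullet> (z - p) + t * ((norm (y - p))\<^sup>2 / 2))"
      by (simp add: algebra_simps power2_eq_square add_divide_distrib diff_divide_distrib)
    then show ?thesis using t by (simp add: zero_le_mult_iff)
  qed
  from nonneg_if_le_small_multiple[OF this] show ?thesis
    using L_pos by (simp add: field_simps)
qed

text \<open>Adding the variational inequalities at \<open>z\<close> and \<open>z'\<close>, each
  tested at the other proximal point, gives firm nonexpansiveness; Cauchy-Schwarz finishes.\<close>

lemma prox_nonexpansive:
  "norm (prox g (1 / L) z - prox g (1 / L) z') \<le> norm (z - z')"
proof -
  define p where "p = prox g (1 / L) z"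
  define p' where "p' = prox g (1 / L) z'"
  have "gr p + L * ((p' - p) \<bullet> (z - p)) \<le> gr p'" "gr p' + L * ((p - p') \<bullet> (z' - p')) \<le> gr p"
    unfolding p_def p'_def by (rule prox_variational[OF prox_dom])+
  then have "L * ((p' - p) \<bullet> (z - p) + (p - p') \<bullet> (z' - p')) \<le> 0"
    by (simp add: algebra_simps)
  then have "(p' - p) \<bullet> (z - p) + (p - p') \<bullet> (z' - p') \<le> 0"
    using L_pos by (simp add: mult_le_0_iff)
  then have "(norm (p - p'))\<^sup>2 \<le> (p - p') \<bullet> (z - z')"
    unfolding power2_norm_eq_inner by (simp add: inner_diff_left inner_diff_right algebra_simps)
  also have "\<dots> \<le> norm (p - p') * norm (z - z')"
    by (rule norm_cauchy_schwarz)
  finally have "norm (p - p') * norm (p - p') \<le> norm (p - p') * norm (z - z')"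
    by (simp add: power2_eq_square)
  then show ?thesis
    by (cases "p = p'") (auto simp flip: p_def p'_def)
qed

lemma continuous_prox: "continuous_on UNIV (prox g (1 / L))"
proof (rule continuous_onI)
  fix z and \<epsilon> :: real assume "\<epsilon> > 0"
  then show "\<exists>d>0. \<forall>z'\<in>UNIV. dist z' z < d \<longrightarrow> dist (prox g (1 / L) z') (prox g (1 / L) z) \<le> \<epsilon>"
    by (intro exI[of _ \<epsilon>]) (auto simp: dist_norm intro: order_trans[OF prox_nonexpansive])
qed

lemma continuous_gradf: "continuous_on UNIV gradf"
proof (rule continuous_onI)
  fix z and \<epsilon> :: real assume "\<epsilon> > 0"
  moreover have "dist (gradf z') (gradf z) \<le> \<epsilon>" if "dist z' z < \<epsilon> / L" for z'
    using lipschitz[of z' z] that L_pos by (simp add: dist_norm field_simps)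
  ultimately show "\<exists>d>0. \<forall>z'\<in>UNIV. dist z' z < d \<longrightarrow> dist (gradf z') (gradf z) \<le> \<epsilon>"
    using L_pos by (intro exI[of _ "\<epsilon> / L"]) auto
qed

lemma borel_measurable_h: "h \<in> borel_measurable borel"
proof (rule borel_measurableI_greater)
  fix c :: ereal
  have "{u. c < h u} \<in> sets borel"
  proof (cases c)
    case (real r)
    have "(c < h u) = (ereal (r - f u) < g u)" for u
      unfolding real h using g_proper[of u] by (cases "g u") auto
    moreover have "open {u. ereal (r - f u) < g u}"
      by (intro lower_semicont_open_above[OF g_lsc] continuous_intros GDERIV_isCont[OF gradf])
    ultimately show ?thesis by simp
  next
    case MInf
    have "h u > -\<infinity>" for u
      unfolding h using g_proper[of u] by (cases "g u") auto
    then show ?thesis by (simp add: MInf)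
  qed simp
  then show "{u \<in> space borel. c < h u} \<in> sets borel" by simp
qed

lemma borel_measurable_opt_gap: "opt_gap h \<in> borel_measurable borel"
proof -
  have [measurable]: "h \<in> borel_measurable borel" by (rule borel_measurable_h)
  show ?thesis unfolding opt_gap_def[abs_def] INF_h by measurable
qed

section \<open>One proximal gradient step with perturbed gradient\<close>

text \<open>The comparison point \<open>y\<close> is left free because the estimate is used twice:
  at \<open>y = u\<close> for descent and at minimisers for the distance to the solution
  set.\<close>

lemma prox_step_bound:
  fixes u y e :: 'a
  assumes y: "g y < \<infinity>"
  defines "p \<equiv> prox g (1 / L) (u - (1 / L) *\<^sub>R (gradf u + e))"
  shows "f p + gr p \<le> f u + (y - u) \<bullet> gradf u + gr y + (y - p) \<bullet> e
           + L / 2 * (norm (y - u))\<^sup>2 - L / 2 * (norm (y - p))\<^sup>2"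
proof -
  have "gr p + L * ((y - p) \<bullet> ((u - (1 / L) *\<^sub>R (gradf u + e)) - p)) \<le> gr y"
    unfolding p_def by (rule prox_variational[OF y])
  moreover have "(y - p) \<bullet> ((u - (1 / L) *\<^sub>R (gradf u + e)) - p)
      = (y - p) \<bullet> (u - p) - (1 / L) * ((y - p) \<bullet> (gradf u + e))"
    by (simp add: inner_diff_right)
  ultimately have "gr p + L * ((y - p) \<bullet> (u - p)) - (y - p) \<bullet> (gradf u + e) \<le> gr y"
    using L_pos by (simp add: algebra_simps)
  moreover have "f p \<le> f u + (p - u) \<bullet> gradf u + L / 2 * (norm (p - u))\<^sup>2"
    by (rule lipschitz_gradient_upper_bound[OF gradf lipschitz])
  \<comment> \<open>The three-point identity; its term in \<open>p - u\<close> cancels the quadratic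
    term of the descent lemma.\<close>
  moreover have "L * ((y - p) \<bullet> (u - p)) = L / 2 * (norm (y - p))\<^sup>2 + L / 2 * (norm (p - u))\<^sup>2 - L / 2 * (norm (y - u))\<^sup>2"
    unfolding power2_norm_eq_inner
    by (simp add: inner_diff_left inner_diff_right inner_commute algebra_simps)
  ultimately show ?thesis
    by (simp add: inner_diff_left inner_add_right algebra_simps)
qed

text \<open>Descent bounds the squared step \<open>D\<close> by \<open>Q - P + E\<close>, and
  minimisers bound \<open>P\<close> by the squared distance to the solution set. The error bound
  controls that distance by \<open>D\<close> and \<open>E\<close>, and eliminating \<open>D\<close>
  yields the contraction.\<close>

lemma opt_gap_step:
  fixes u e :: 'a and \<tau> :: real
  assumes \<tau>: "1 \<le> \<tau>"
    and error_bound: "infdist u (argmin_set h) \<le> \<tau> * norm (u - prox g (1 / L) (u - (1 / L) *\<^sub>R gradf u))"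
    and u: "g u < \<infinity>"
  defines "p \<equiv> prox g (1 / L) (u - (1 / L) *\<^sub>R (gradf u + e))"
  shows "opt_gap h p \<le> 8 * \<tau>\<^sup>2 / (1 + 8 * \<tau>\<^sup>2) * opt_gap h u + 2 / L * (norm e)\<^sup>2"
proof -
  define P Q E D where "P = opt_gap h p" and "Q = opt_gap h u" and "E = (norm e)\<^sup>2 / L"
    and "D = L * (norm (u - p))\<^sup>2"
  have gp: "g p < \<infinity>" unfolding p_def by (rule prox_dom)
  \<comment> \<open>Young's inequality with a free weight: \<open>c = 1 / 2\<close> leaves a quarter
    of \<open>D\<close> in the descent estimate, while \<open>c = 1\<close> exactly absorbs the
    negative quadratic term at a minimiser.\<close>
  have young: "v \<bullet> e \<le> c * L / 2 * (norm v)\<^sup>2 + E / (2 * c)" if "c > 0" for v and c :: real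
  proof -
    have "0 \<le> (norm ((c * L) *\<^sub>R v - e))\<^sup>2 / (2 * c * L)"
      using that L_pos by simp
    also have "\<dots> = c * L / 2 * (norm v)\<^sup>2 - v \<bullet> e + E / (2 * c)"
      using that L_pos unfolding power2_norm_eq_inner E_def
      by (simp add: inner_diff_left inner_diff_right inner_commute field_simps power2_eq_square)
    finally show ?thesis by simp
  qed
  have descent: "D / 4 \<le> Q - P + E"
    using prox_step_bound[OF u, of u e] young[of "1 / 2" "u - p"]
    by (simp add: P_def Q_def D_def opt_gap_eq[OF u] opt_gap_eq[OF gp] flip: p_def)
  have near: "P - E / 2 \<le> L * (norm (u - s))\<^sup>2" if s: "s \<in> argmin_set h" for s
    using prox_step_bound[OF minimizer(1)[OF s], of u e] young[of 1 "s - p"]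
      lipschitz_gradient_lower_bound[OF gradf lipschitz, of u s] minimizer(2)[OF s]
    by (simp add: P_def opt_gap_eq[OF gp] norm_minus_commute flip: p_def)
  \<comment> \<open>Taking square roots first lets the bound pass to the infimum over all
    minimisers, so no nearest point has to be chosen.\<close>
  have dist: "P - E / 2 \<le> L * (infdist u (argmin_set h))\<^sup>2"
  proof (cases "P - E / 2 \<le> 0")
    case True
    then show ?thesis using L_pos by (meson less_imp_le mult_nonneg_nonneg order_trans zero_le_power2)
  next
    case False
    have "sqrt ((P - E / 2) / L) \<le> dist u s" if "s \<in> argmin_set h" for s
      using near[OF that] L_pos by (intro real_le_lsqrt) (auto simp: field_simps dist_norm)
    then have "sqrt ((P - E / 2) / L) \<le> infdist u (argmin_set h)"
      unfolding infdist_notempty[OF S_nonempty] by (intro cINF_greatest S_nonempty)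
    then have "(sqrt ((P - E / 2) / L))\<^sup>2 \<le> (infdist u (argmin_set h))\<^sup>2"
      using False L_pos by (intro power_mono) auto
    then show ?thesis using False L_pos by (simp add: field_simps)
  qed
  \<comment> \<open>The error bound concerns the step with exact gradient; by nonexpansiveness its
    end point differs from \<open>p\<close> by at most \<open>norm e / L\<close>.\<close>
  have "L * (norm (u - prox g (1 / L) (u - (1 / L) *\<^sub>R gradf u)))\<^sup>2 \<le> 2 * D + 2 * E"
  proof -
    let ?q = "prox g (1 / L) (u - (1 / L) *\<^sub>R gradf u)"
    have "norm (u - ?q) \<le> norm (u - p) + norm (p - ?q)"
      using norm_triangle_ineq[of "u - p" "p - ?q"] by simp
    also have "norm (p - ?q) \<le> norm e / L"
      unfolding p_def using L_pos
      by (rule_tac order_trans[OF prox_nonexpansive]) (simp add: scaleR_add_right)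
    finally have "(norm (u - ?q))\<^sup>2 \<le> (norm (u - p) + norm e / L)\<^sup>2"
      by (intro power_mono) auto
    also have "\<dots> \<le> 2 * (norm (u - p))\<^sup>2 + 2 * (norm e / L)\<^sup>2"
      using sum_squares_bound[of "norm (u - p)" "norm e / L"] by (simp add: power2_sum)
    finally have "L * (norm (u - ?q))\<^sup>2 \<le> L * (2 * (norm (u - p))\<^sup>2 + 2 * (norm e / L)\<^sup>2)"
      using L_pos by (intro mult_left_mono) auto
    also have "\<dots> = 2 * D + 2 * E"
      using L_pos by (simp add: D_def E_def field_simps power2_eq_square)
    finally show ?thesis .
  qed
  moreover have "(infdist u (argmin_set h))\<^sup>2 \<le> \<tau>\<^sup>2 * (norm (u - prox g (1 / L) (u - (1 / L) *\<^sub>R gradf u)))\<^sup>2"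
    using power_mono[OF error_bound infdist_nonneg, of 2] by (simp add: power_mult_distrib)
  ultimately have "P - E / 2 \<le> \<tau>\<^sup>2 * (2 * D + 2 * E)"
    using dist L_pos
    by (smt (verit, best) mult.left_commute mult_left_mono zero_le_power2)
  also have "\<dots> \<le> \<tau>\<^sup>2 * (8 * (Q - P + E) + 2 * E)"
    using descent by (intro mult_left_mono) auto
  finally have "P * (1 + 8 * \<tau>\<^sup>2) \<le> 8 * \<tau>\<^sup>2 * Q + (10 * \<tau>\<^sup>2 + 1 / 2) * E"
    by (simp add: algebra_simps)
  \<comment> \<open>Rounding the coefficient of \<open>E\<close> up to a multiple of
    \<open>1 + 8 * \<tau>\<^sup>2\<close> makes the error term free of \<open>\<tau>\<close> after
    division.\<close>
  also have "\<dots> \<le> 8 * \<tau>\<^sup>2 * Q + (2 * (1 + 8 * \<tau>\<^sup>2)) * E"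
    using L_pos by (intro add_left_mono mult_right_mono) (auto simp: E_def)
  finally have "P \<le> (8 * \<tau>\<^sup>2 * Q + (2 * (1 + 8 * \<tau>\<^sup>2)) * E) / (1 + 8 * \<tau>\<^sup>2)"
    by (simp add: pos_le_divide_eq add_pos_nonneg)
  also have "\<dots> = 8 * \<tau>\<^sup>2 / (1 + 8 * \<tau>\<^sup>2) * Q + 2 * E"
  proof -
    have "1 + 8 * \<tau>\<^sup>2 \<noteq> 0" by (smt (verit) zero_le_power2)
    then show ?thesis by (simp add: field_simps)
  qed
  finally show ?thesis by (simp add: P_def Q_def E_def)
qed

end

subsection \<open>Measurability and expectation of sampled gradients\<close>

text \<open>Replace \<open>u\<close> by the first point of a countable dense sequence within
  distance 1 / (n + 1). The resulting functions are measurable as countable compositions and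
  converge by continuity in \<open>u\<close>.\<close>

lemma borel_measurable_Caratheodory:
  fixes F :: "'a::{second_countable_topology, metric_space} \<Rightarrow> 'z \<Rightarrow> 'b::metric_space"
  assumes F [measurable]: "\<And>u. F u \<in> borel_measurable N"
    and cont: "\<And>u z. z \<in> space N \<Longrightarrow> isCont (\<lambda>v. F v z) u"
  shows "(\<lambda>(u, z). F u z) \<in> borel_measurable (borel \<Otimes>\<^sub>M N)"
proof -
  obtain D :: "'a set" where D: "countable D" "\<And>X. open X \<Longrightarrow> X \<noteq> {} \<Longrightarrow> \<exists>d\<in>D. d \<in> X"
    using countable_dense_setE by blast
  define d where "d = from_nat_into D"
  have near: "\<exists>k. dist (d k) u < r" if "r > 0" for u r
  proof -
    obtain a where "a \<in> D" "a \<in> ball u r"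
      using D(2)[of "ball u r"] \<open>r > 0\<close> by fastforce
    moreover from this obtain k where "d k = a"
      unfolding d_def using from_nat_into_surj[OF D(1)] by blast
    ultimately show ?thesis by (auto simp: dist_commute)
  qed
  define k where "k n u = (LEAST j. dist (d j) u < inverse (real (Suc n)))" for n u
  have k: "dist (d (k n u)) u < inverse (real (Suc n))" for n u
    unfolding k_def by (rule LeastI_ex) (rule near, simp)
  have [measurable]: "k n \<in> measurable borel (count_space UNIV)" for n
    unfolding k_def by measurable
  have "(\<lambda>p. F (d (k n (fst p))) (snd p)) \<in> borel_measurable (borel \<Otimes>\<^sub>M N)" for n
    by (rule measurable_compose_countable[where f = "\<lambda>j p. F (d j) (snd p)"]) measurable
  moreover have "(\<lambda>n. F (d (k n (fst p))) (snd p)) \<longlonglongrightarrow> F (fst p) (snd p)"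
    if "p \<in> space (borel \<Otimes>\<^sub>M N)" for p
  proof -
    have "(\<lambda>n. dist (d (k n (fst p))) (fst p)) \<longlonglongrightarrow> 0"
      by (rule real_tendsto_sandwich[OF _ _ tendsto_const LIMSEQ_inverse_real_of_nat])
        (use k in \<open>auto intro!: always_eventually intro: less_imp_le\<close>)
    then have "(\<lambda>n. d (k n (fst p))) \<longlonglongrightarrow> fst p"
      by (simp add: tendsto_dist_iff[of _ "fst p"])
    moreover have "isCont (\<lambda>v. F v (snd p)) (fst p)"
      using that by (intro cont) (auto simp: space_pair_measure)
    ultimately show ?thesis by (rule isCont_tendsto_compose[rotated])
  qed
  ultimately have "(\<lambda>p. F (fst p) (snd p)) \<in> borel_measurable (borel \<Otimes>\<^sub>M N)"
    by (rule borel_measurable_LIMSEQ_metric)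
  then show ?thesis by (simp add: case_prod_beta')
qed

lemma GDERIV_quotient_LIMSEQ:
  fixes f :: "'a::real_inner \<Rightarrow> real"
  assumes "GDERIV f u :> D"
  shows "(\<lambda>n. (f (u + inverse (real (Suc n)) *\<^sub>R b) - f u) / inverse (real (Suc n))) \<longlonglongrightarrow> b \<bullet> D"
proof -
  have "((\<lambda>s. f (u + s *\<^sub>R b)) has_real_derivative b \<bullet> D) (at 0)"
    by (rule GDERIV_line) (use assms in simp)
  then have "((\<lambda>s. (f (u + s *\<^sub>R b) - f u) / s) \<longlongrightarrow> b \<bullet> D) (at 0)"
    by (simp add: DERIV_def)
  moreover have "filterlim (\<lambda>n. inverse (real (Suc n))) (at 0) sequentially"
    by (intro filterlim_atI LIMSEQ_inverse_real_of_nat) auto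
  ultimately show ?thesis by (rule filterlim_compose)
qed

text \<open>\<open>gradF\<close> need not be continuous in \<open>u\<close>, but \<open>F\<close>
  is, being differentiable; so difference quotients are jointly measurable and directional
  derivatives are their sequential limits.\<close>

lemma borel_measurable_gradient:
  fixes F :: "'a::euclidean_space \<Rightarrow> 'z \<Rightarrow> real"
  assumes F: "\<And>u. F u \<in> borel_measurable N"
    and gradF: "\<And>u z. z \<in> space N \<Longrightarrow> GDERIV (\<lambda>v. F v z) u :> gradF u z"
  shows "(\<lambda>(u, z). gradF u z) \<in> borel_measurable (borel \<Otimes>\<^sub>M N)"
proof -
  have joint: "(\<lambda>(u, z). F u z) \<in> borel_measurable (borel \<Otimes>\<^sub>M N)"
    by (rule borel_measurable_Caratheodory[OF F]) (rule GDERIV_isCont[OF gradF])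
  have [measurable]: "(\<lambda>p. F (fst p + c) (snd p)) \<in> borel_measurable (borel \<Otimes>\<^sub>M N)" for c
    using measurable_compose[OF _ joint, of "\<lambda>p. (fst p + c, snd p)" "borel \<Otimes>\<^sub>M N"] by simp
  have [measurable]: "(\<lambda>p. F (fst p) (snd p)) \<in> borel_measurable (borel \<Otimes>\<^sub>M N)"
    using joint by (simp add: case_prod_beta')
  have "(\<lambda>p. gradF (fst p) (snd p) \<bullet> b) \<in> borel_measurable (borel \<Otimes>\<^sub>M N)" for b
  proof (rule borel_measurable_LIMSEQ_metric)
    show "(\<lambda>p. (F (fst p + inverse (real (Suc n)) *\<^sub>R b) (snd p) - F (fst p) (snd p)) / inverse (real (Suc n)))
      \<in> borel_measurable (borel \<Otimes>\<^sub>M N)" for n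
      by measurable
    show "(\<lambda>n. (F (fst p + inverse (real (Suc n)) *\<^sub>R b) (snd p) - F (fst p) (snd p)) / inverse (real (Suc n)))
      \<longlonglongrightarrow> gradF (fst p) (snd p) \<bullet> b" if "p \<in> space (borel \<Otimes>\<^sub>M N)" for p
      using that GDERIV_quotient_LIMSEQ[OF gradF, of "snd p" "fst p" b]
      by (auto simp: space_pair_measure inner_commute)
  qed
  then show ?thesis
    by (subst borel_measurable_euclidean_space) (simp add: case_prod_beta')
qed

section \<open>Limits and derivatives under the expectation with bounds in mean square\<close>

lemma (in prob_space) integrable_if_square_bounded:
  fixes q :: "'a \<Rightarrow> real"
  assumes [measurable]: "q \<in> borel_measurable M" and C: "(\<integral>\<^sup>+\<omega>. ennreal ((q \<omega>)\<^sup>2) \<partial>M) \<le> ennreal C"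
  shows "integrable M (\<lambda>\<omega>. (q \<omega>)\<^sup>2)" "integrable M q" "C \<ge> 0 \<Longrightarrow> (\<integral>\<omega>. (q \<omega>)\<^sup>2 \<partial>M) \<le> C"
proof -
  show i: "integrable M (\<lambda>\<omega>. (q \<omega>)\<^sup>2)"
    by (rule integrableI_bounded) (use C in \<open>auto intro: le_less_trans\<close>)
  show "integrable M q"
  proof (rule Bochner_Integration.integrable_bound)
    show "integrable M (\<lambda>\<omega>. 1 + (q \<omega>)\<^sup>2)" using i by simp
    have "\<bar>y\<bar> \<le> 1 + y\<^sup>2" for y :: real
      using sum_squares_bound[of 1 "\<bar>y\<bar>"] by simp
    then show "AE \<omega> in M. norm (q \<omega>) \<le> norm (1 + (q \<omega>)\<^sup>2)"
      by (auto intro: order_trans)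
  qed simp
  show "(\<integral>\<omega>. (q \<omega>)\<^sup>2 \<partial>M) \<le> C" if "C \<ge> 0"
    using C that i by (simp add: nn_integral_eq_integral)
qed

text \<open>A case of Vitali's convergence theorem: boundedness in mean square supplies the uniform
  integrability.\<close>
lemma (in prob_space) expectation_LIMSEQ_square_bounded:
  fixes q :: "nat \<Rightarrow> 'a \<Rightarrow> real"
  assumes q [measurable]: "\<And>n. q n \<in> borel_measurable M"
    and lim: "\<And>\<omega>. \<omega> \<in> space M \<Longrightarrow> (\<lambda>n. q n \<omega>) \<longlonglongrightarrow> r \<omega>"
    and C: "\<And>n. (\<integral>\<^sup>+\<omega>. ennreal ((q n \<omega>)\<^sup>2) \<partial>M) \<le> ennreal C" and C0: "0 \<le> C"
  shows "integrable M r" "(\<lambda>n. expectation (q n)) \<longlonglongrightarrow> expectation r"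
proof -
  have r [measurable]: "r \<in> borel_measurable M"
    by (rule borel_measurable_LIMSEQ_metric[OF q lim])
  \<comment> \<open>Fatou's lemma carries the mean square bound over to the limit.\<close>
  have "(\<integral>\<^sup>+\<omega>. ennreal ((r \<omega>)\<^sup>2) \<partial>M) = (\<integral>\<^sup>+\<omega>. liminf (\<lambda>n. ennreal ((q n \<omega>)\<^sup>2)) \<partial>M)"
  proof (intro nn_integral_cong)
    fix \<omega> assume "\<omega> \<in> space M"
    then have "(\<lambda>n. ennreal ((q n \<omega>)\<^sup>2)) \<longlonglongrightarrow> ennreal ((r \<omega>)\<^sup>2)"
      by (intro tendsto_ennrealI tendsto_power lim)
    then show "ennreal ((r \<omega>)\<^sup>2) = liminf (\<lambda>n. ennreal ((q n \<omega>)\<^sup>2))"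
      by (intro lim_imp_Liminf[symmetric]) auto
  qed
  also have "\<dots> \<le> liminf (\<lambda>n. \<integral>\<^sup>+\<omega>. ennreal ((q n \<omega>)\<^sup>2) \<partial>M)"
    by (intro nn_integral_liminf) simp
  also have "\<dots> \<le> ennreal C"
    using C by (intro order_trans[OF Liminf_le_Limsup] Limsup_bounded) (auto intro: always_eventually)
  finally have rC: "(\<integral>\<^sup>+\<omega>. ennreal ((r \<omega>)\<^sup>2) \<partial>M) \<le> ennreal C" .
  note r_int = integrable_if_square_bounded[OF r rC]
  note q_int = integrable_if_square_bounded[OF q C]
  show "integrable M r" by (rule r_int)
  \<comment> \<open>Where the difference exceeds \<open>R\<close> it is at most its square divided
    by \<open>R\<close>, which costs \<open>4 * C / R\<close> uniformly in \<open>n\<close>; the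
    truncated part is left to dominated convergence.\<close>
  have trunc: "\<bar>expectation (q n) - expectation r\<bar>
      \<le> expectation (\<lambda>\<omega>. min \<bar>q n \<omega> - r \<omega>\<bar> R) + 4 * C / R" if R: "R > 0" for n R
  proof -
    have int: "integrable M (\<lambda>\<omega>. min \<bar>q n \<omega> - r \<omega>\<bar> R)"
      by (rule integrable_const_bound[where B = R]) (use R in auto)
    have pt: "\<bar>a - b\<bar> \<le> min \<bar>a - b\<bar> R + 2 / R * (a\<^sup>2 + b\<^sup>2)" for a b :: real
    proof (cases "\<bar>a - b\<bar> \<le> R")
      case False
      have "\<bar>a - b\<bar> * R \<le> \<bar>a - b\<bar> * \<bar>a - b\<bar>"
        using False by (intro mult_left_mono) auto
      also have "\<dots> = (a - b)\<^sup>2" by (simp add: power2_eq_square)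
      also have "\<dots> \<le> 2 * (a\<^sup>2 + b\<^sup>2)"
        using zero_le_power2[of "a + b"] by (simp add: power2_sum power2_diff)
      finally have "\<bar>a - b\<bar> \<le> 2 / R * (a\<^sup>2 + b\<^sup>2)"
        using R by (simp add: field_simps)
      then show ?thesis using R by simp
    qed (use R in simp)
    have "\<bar>expectation (q n) - expectation r\<bar> = \<bar>expectation (\<lambda>\<omega>. q n \<omega> - r \<omega>)\<bar>"
      using q_int(2) r_int(2) by simp
    also have "\<dots> \<le> expectation (\<lambda>\<omega>. \<bar>q n \<omega> - r \<omega>\<bar>)"
      by (rule integral_abs_bound)
    also have "\<dots> \<le> expectation (\<lambda>\<omega>. min \<bar>q n \<omega> - r \<omega>\<bar> R + 2 / R * ((q n \<omega>)\<^sup>2 + (r \<omega>)\<^sup>2))"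
      using int q_int r_int by (intro integral_mono pt) auto
    also have "\<dots> = expectation (\<lambda>\<omega>. min \<bar>q n \<omega> - r \<omega>\<bar> R)
        + 2 / R * (expectation (\<lambda>\<omega>. (q n \<omega>)\<^sup>2) + expectation (\<lambda>\<omega>. (r \<omega>)\<^sup>2))"
      using int q_int r_int by simp
    also have "\<dots> \<le> expectation (\<lambda>\<omega>. min \<bar>q n \<omega> - r \<omega>\<bar> R) + 2 / R * (C + C)"
      using q_int(3) r_int(3) C0 R by (intro add_left_mono mult_left_mono add_mono) auto
    finally show ?thesis by simp
  qed
  have dct: "(\<lambda>n. expectation (\<lambda>\<omega>. min \<bar>q n \<omega> - r \<omega>\<bar> R)) \<longlonglongrightarrow> expectation (\<lambda>\<omega>. 0)" if R: "R > 0" for R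
  proof (rule integral_dominated_convergence[where w = "\<lambda>_. R"])
    show "AE \<omega> in M. (\<lambda>n. min \<bar>q n \<omega> - r \<omega>\<bar> R) \<longlonglongrightarrow> 0"
    proof (rule AE_I2)
      fix \<omega> assume "\<omega> \<in> space M"
      have "(\<lambda>n. min \<bar>q n \<omega> - r \<omega>\<bar> R) \<longlonglongrightarrow> min \<bar>r \<omega> - r \<omega>\<bar> R"
        by (intro tendsto_intros lim) fact
      then show "(\<lambda>n. min \<bar>q n \<omega> - r \<omega>\<bar> R) \<longlonglongrightarrow> 0" using R by simp
    qed
  qed (use R in auto)
  show "(\<lambda>n. expectation (q n)) \<longlonglongrightarrow> expectation r"
  proof (rule LIMSEQ_I)
    fix \<epsilon> :: real assume \<epsilon>: "\<epsilon> > 0"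
    define R where "R = 8 * (C + 1) / \<epsilon>"
    have R: "R > 0" and small: "4 * C / R < \<epsilon> / 2 "
      using \<epsilon> C0 by (auto simp: R_def field_simps)
    have "\<forall>\<^sub>F n in sequentially. expectation (\<lambda>\<omega>. min \<bar>q n \<omega> - r \<omega>\<bar> R) < \<epsilon> / 2"
      using dct[OF R] \<epsilon> by (intro order_tendstoD) auto
    then obtain n0 where "\<And>n. n \<ge> n0 \<Longrightarrow> expectation (\<lambda>\<omega>. min \<bar>q n \<omega> - r \<omega>\<bar> R) < \<epsilon> / 2"
      by (auto simp: eventually_sequentially)
    then have "norm (expectation (q n) - expectation r) < \<epsilon>" if "n \<ge> n0" for n
      using trunc[OF R, of n] small that by fastforce
    then show "\<exists>n0. \<forall>n\<ge>n0. norm (expectation (q n) - expectation r) < \<epsilon>" by blast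
  qed
qed

text \<open>The derivatives need not be continuous, but a derivative that exists everywhere and is
  Lebesgue integrable satisfies the fundamental theorem of calculus, by way of the gauge integral.\<close>
lemma square_increment_le_nn_integral:
  fixes \<phi> :: "real \<Rightarrow> real"
  assumes deriv: "\<And>s. (\<phi> has_real_derivative \<phi>' s) (at s)"
    and [measurable]: "\<phi>' \<in> borel_measurable borel"
  shows "ennreal ((\<phi> 1 - \<phi> 0)\<^sup>2) \<le> (\<integral>\<^sup>+s. ennreal ((\<phi>' s)\<^sup>2) \<partial>restrict_space lborel {0..1})"
proof (cases "(\<integral>\<^sup>+s. ennreal ((\<phi>' s)\<^sup>2) \<partial>restrict_space lborel {0..1}) = \<infinity>")
  case False
  define \<mu> where "\<mu> = restrict_space lborel {0..1::real}"
  interpret \<mu>: prob_space \<mu>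
    unfolding \<mu>_def by (rule prob_space_restrict_space) auto
  have meas: "\<phi>' \<in> borel_measurable \<mu>"
    unfolding \<mu>_def by (rule measurable_restrict_space1) simp
  define C where "C = enn2real (\<integral>\<^sup>+s. ennreal ((\<phi>' s)\<^sup>2) \<partial>\<mu>)"
  have C: "(\<integral>\<^sup>+s. ennreal ((\<phi>' s)\<^sup>2) \<partial>\<mu>) = ennreal C"
    using False by (simp add: C_def \<mu>_def ennreal_enn2real top.not_eq_extremum)
  note int = \<mu>.integrable_if_square_bounded[OF meas eq_refl[OF C]]
  have "set_integrable lborel {0..1} \<phi>'"
    using int(2) by (simp add: \<mu>_def integrable_restrict_space set_integrable_def)
  from set_borel_integral_eq_integral[OF this]
  have "\<mu>.expectation \<phi>' = integral {0..1} \<phi>'"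
    by (simp add: \<mu>_def integral_restrict_space set_lebesgue_integral_def)
  also have "(\<phi>' has_integral (\<phi> 1 - \<phi> 0)) {0..1}"
    by (rule fundamental_theorem_of_calculus)
      (auto simp flip: has_real_derivative_iff_has_vector_derivative intro: has_field_derivative_at_within deriv)
  then have "integral {0..1} \<phi>' = \<phi> 1 - \<phi> 0"
    by (rule integral_unique)
  finally have e: "\<mu>.expectation \<phi>' = \<phi> 1 - \<phi> 0" .
  \<comment> \<open>Nonnegativity of the variance of \<open>\<phi>'\<close> under the uniform
    distribution on the unit interval.\<close>
  have "(\<phi> 1 - \<phi> 0)\<^sup>2 \<le> \<mu>.expectation (\<lambda>s. (\<phi>' s)\<^sup>2)"
    using \<mu>.variance_positive[of \<phi>', unfolded \<mu>.variance_eq[OF int(2,1)]] by (simp add: e)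
  also have "\<dots> \<le> C" by (rule int(3)) (auto simp: C_def)
  finally show ?thesis
    unfolding \<mu>_def[symmetric] C by (rule ennreal_leI)
qed simp

text \<open>The squared difference quotient is at most the average along the segment of the squared
  directional derivative. By Tonelli its mean is bounded uniformly in the step, so expectations of
  the quotients converge to that of the derivative; they are also quotients of
  \<open>\<phi>\<close>.\<close>

lemma (in prob_space) expectation_gradient:
  fixes \<psi> :: "'b::euclidean_space \<Rightarrow> 'a \<Rightarrow> real"
  assumes int: "\<And>u. integrable M (\<psi> u)"
    and G: "\<And>u z. z \<in> space M \<Longrightarrow> GDERIV (\<lambda>v. \<psi> v z) u :> G u z"
    and \<phi>: "\<And>u. expectation (\<psi> u) = \<phi> u"
    and d\<phi>: "GDERIV \<phi> u :> d\<phi>"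
    and C: "\<And>u. (\<integral>\<^sup>+z. ennreal ((norm (G u z))\<^sup>2) \<partial>M) \<le> ennreal C" and C0: "0 \<le> C"
  shows "integrable M (\<lambda>z. G u z \<bullet> b)" "expectation (\<lambda>z. G u z \<bullet> b) = d\<phi> \<bullet> b"
proof -
  have [measurable]: "\<psi> v \<in> borel_measurable M" for v
    using int by (rule borel_measurable_integrable)
  have Gm [measurable]: "(\<lambda>(u, z). G u z) \<in> borel_measurable (borel \<Otimes>\<^sub>M M)"
    by (rule borel_measurable_gradient[where F = \<psi>]) (auto intro: G)
  define \<mu> where "\<mu> = restrict_space lborel {0..1::real}"
  interpret \<mu>: prob_space \<mu>
    unfolding \<mu>_def by (rule prob_space_restrict_space) auto
  interpret pair_sigma_finite \<mu> M ..
  define t where "t n = inverse (real (Suc n))" for n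
  have t: "t n > 0" for n by (simp add: t_def)
  define q where "q n z = (\<psi> (u + t n *\<^sub>R b) z - \<psi> u z) / t n" for n z
  have [measurable]: "q n \<in> borel_measurable M" for n
    unfolding q_def by measurable
  have lim: "(\<lambda>n. q n z) \<longlonglongrightarrow> G u z \<bullet> b" if "z \<in> space M" for z
    using GDERIV_quotient_LIMSEQ[OF G[OF that], of u b] by (simp add: q_def t_def inner_commute)
  have bound: "(\<integral>\<^sup>+z. ennreal ((q n z)\<^sup>2) \<partial>M) \<le> ennreal ((norm b)\<^sup>2 * C)" for n
  proof -
    have path [measurable]: "(\<lambda>s. u + (s * t n) *\<^sub>R b) \<in> borel_measurable \<mu>"
      unfolding \<mu>_def by (rule measurable_restrict_space1) measurable
    have [measurable]: "(\<lambda>(s, z). b \<bullet> G (u + (s * t n) *\<^sub>R b) z) \<in> borel_measurable (\<mu> \<Otimes>\<^sub>M M)"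
      using measurable_compose[OF _ Gm, of "\<lambda>p. (u + (fst p * t n) *\<^sub>R b, snd p)" "\<mu> \<Otimes>\<^sub>M M"]
      by (simp add: case_prod_beta')
    have "ennreal ((q n z)\<^sup>2) \<le> (\<integral>\<^sup>+s. ennreal ((b \<bullet> G (u + (s * t n) *\<^sub>R b) z)\<^sup>2) \<partial>\<mu>)"
      if z: "z \<in> space M" for z
    proof -
      define w where "w s = \<psi> (u + (s * t n) *\<^sub>R b) z / t n" for s
      have "((\<lambda>s. \<psi> (u + s *\<^sub>R b) z) has_real_derivative b \<bullet> G (u + (s * t n) *\<^sub>R b) z) (at (s * t n))" for s
        by (rule GDERIV_line[OF G[OF z]])
      then have d: "((\<lambda>s. \<psi> (u + (s * t n) *\<^sub>R b) z) has_real_derivative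
          (b \<bullet> G (u + (s * t n) *\<^sub>R b) z) * t n) (at s)" for s
        by (rule DERIV_chain2) (auto intro!: derivative_eq_intros)
      have "(w has_real_derivative b \<bullet> G (u + (s * t n) *\<^sub>R b) z) (at s)" for s
        using DERIV_cdivide[OF d[of s], of "t n"] t[of n] by (simp add: w_def[abs_def])
      moreover have "(\<lambda>s. b \<bullet> G (u + (s * t n) *\<^sub>R b) z) \<in> borel_measurable borel"
        using measurable_compose[OF _ Gm, of "\<lambda>s. (u + (s * t n) *\<^sub>R b, z)" borel] z by simp
      ultimately show ?thesis
        using square_increment_le_nn_integral[of w "\<lambda>s. b \<bullet> G (u + (s * t n) *\<^sub>R b) z"]
        by (simp add: w_def q_def \<mu>_def diff_divide_distrib)
    qed
    then have "(\<integral>\<^sup>+z. ennreal ((q n z)\<^sup>2) \<partial>M)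
        \<le> (\<integral>\<^sup>+z. \<integral>\<^sup>+s. ennreal ((b \<bullet> G (u + (s * t n) *\<^sub>R b) z)\<^sup>2) \<partial>\<mu> \<partial>M)"
      by (intro nn_integral_mono)
    also have "\<dots> = (\<integral>\<^sup>+s. \<integral>\<^sup>+z. ennreal ((b \<bullet> G (u + (s * t n) *\<^sub>R b) z)\<^sup>2) \<partial>M \<partial>\<mu>)"
      by (rule Fubini') measurable
    also have "\<dots> \<le> (\<integral>\<^sup>+s. ennreal ((norm b)\<^sup>2 * C) \<partial>\<mu>)"
    proof (intro nn_integral_mono)
      fix s
      have [measurable]: "(\<lambda>z. G (u + (s * t n) *\<^sub>R b) z) \<in> borel_measurable M"
        using measurable_compose[OF _ Gm, of "\<lambda>z. (u + (s * t n) *\<^sub>R b, z)" M] by simp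
      have "(b \<bullet> v)\<^sup>2 \<le> (norm b)\<^sup>2 * (norm v)\<^sup>2" for v
        using Cauchy_Schwarz_ineq[of b v] by (simp add: power2_norm_eq_inner)
      then have "(\<integral>\<^sup>+z. ennreal ((b \<bullet> G (u + (s * t n) *\<^sub>R b) z)\<^sup>2) \<partial>M)
        \<le> (\<integral>\<^sup>+z. ennreal ((norm b)\<^sup>2) * ennreal ((norm (G (u + (s * t n) *\<^sub>R b) z))\<^sup>2) \<partial>M)"
        by (intro nn_integral_mono) (simp flip: ennreal_mult')
      also have "\<dots> = ennreal ((norm b)\<^sup>2) * (\<integral>\<^sup>+z. ennreal ((norm (G (u + (s * t n) *\<^sub>R b) z))\<^sup>2) \<partial>M)"
        by (intro nn_integral_cmult) measurable
      also have "\<dots> \<le> ennreal ((norm b)\<^sup>2) * ennreal C"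
        by (intro mult_left_mono C) simp
      finally show "(\<integral>\<^sup>+z. ennreal ((b \<bullet> G (u + (s * t n) *\<^sub>R b) z)\<^sup>2) \<partial>M) \<le> ennreal ((norm b)\<^sup>2 * C)"
        using C0 by (simp add: ennreal_mult)
    qed
    also have "\<dots> = ennreal ((norm b)\<^sup>2 * C)"
      by (simp add: \<mu>.emeasure_space_1)
    finally show ?thesis .
  qed
  have C0': "0 \<le> (norm b)\<^sup>2 * C" using C0 by simp
  note vitali = expectation_LIMSEQ_square_bounded[OF _ lim bound C0', simplified]
  show "integrable M (\<lambda>z. G u z \<bullet> b)" by (rule vitali(1))
  have "expectation (q n) = (\<phi> (u + t n *\<^sub>R b) - \<phi> u) / t n" for n
    unfolding q_def using int by (simp add: \<phi>)
  moreover have "(\<lambda>n. (\<phi> (u + t n *\<^sub>R b) - \<phi> u) / t n) \<longlonglongrightarrow> d\<phi> \<bullet> b"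
    using GDERIV_quotient_LIMSEQ[OF d\<phi>, of b] by (simp add: t_def inner_commute)
  ultimately show "expectation (\<lambda>z. G u z \<bullet> b) = d\<phi> \<bullet> b"
    using vitali(2) by (auto intro: LIMSEQ_unique)
qed

subsection \<open>Conditioning on independent variables, and averages\<close>

text \<open>The joint law is a product, so by Tonelli the first variable can be frozen in the inner
  integral.\<close>

lemma (in prob_space) nn_integral_indep_var_le:
  assumes ind: "indep_var S X T Y" and [measurable]: "\<phi> \<in> borel_measurable (S \<Otimes>\<^sub>M T)"
    and le: "\<And>u. u \<in> space S \<Longrightarrow> (\<integral>\<^sup>+\<omega>. \<phi> (u, Y \<omega>) \<partial>M) \<le> C"
  shows "(\<integral>\<^sup>+\<omega>. \<phi> (X \<omega>, Y \<omega>) \<partial>M) \<le> C"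
proof -
  note [measurable] = indep_var_rv1[OF ind] indep_var_rv2[OF ind]
  interpret X: prob_space "distr M S X" by (rule prob_space_distr) simp
  interpret Y: prob_space "distr M T Y" by (rule prob_space_distr) simp
  interpret pair_sigma_finite "distr M S X" "distr M T Y" ..
  have "(\<integral>\<^sup>+\<omega>. \<phi> (X \<omega>, Y \<omega>) \<partial>M) = (\<integral>\<^sup>+p. \<phi> p \<partial>distr M (S \<Otimes>\<^sub>M T) (\<lambda>\<omega>. (X \<omega>, Y \<omega>)))"
    by (subst nn_integral_distr) auto
  also have "\<dots> = (\<integral>\<^sup>+p. \<phi> p \<partial>(distr M S X \<Otimes>\<^sub>M distr M T Y))"
    using ind by (simp add: indep_var_distribution_eq)
  also have "\<dots> = (\<integral>\<^sup>+u. \<integral>\<^sup>+v. \<phi> (u, v) \<partial>distr M T Y \<partial>distr M S X)"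
    by (rule Y.nn_integral_fst[symmetric]) simp
  also have "\<dots> \<le> (\<integral>\<^sup>+u. C \<partial>distr M S X)"
  proof (intro nn_integral_mono)
    fix u assume "u \<in> space (distr M S X)"
    then have u: "u \<in> space S" by simp
    then show "(\<integral>\<^sup>+v. \<phi> (u, v) \<partial>distr M T Y) \<le> C"
      by (subst nn_integral_distr) (auto intro: le)
  qed
  also have "\<dots> = C" using X.emeasure_space_1 by simp
  finally show ?thesis .
qed

text \<open>Mixed products have mean zero by independence and centring, so only the diagonal of the
  expanded square remains.\<close>

lemma (in prob_space) expectation_square_sum_indep:
  fixes X :: "'i \<Rightarrow> 'a \<Rightarrow> real"
  assumes fin: "finite I" and ind: "indep_vars (\<lambda>_. borel) X I"
    and int: "\<And>i. i \<in> I \<Longrightarrow> integrable M (X i)"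
    and sq: "\<And>i. i \<in> I \<Longrightarrow> integrable M (\<lambda>\<omega>. (X i \<omega>)\<^sup>2)"
    and mean: "\<And>i. i \<in> I \<Longrightarrow> expectation (X i) = 0"
  shows "integrable M (\<lambda>\<omega>. (\<Sum>i\<in>I. X i \<omega>)\<^sup>2)"
    "expectation (\<lambda>\<omega>. (\<Sum>i\<in>I. X i \<omega>)\<^sup>2) = (\<Sum>i\<in>I. expectation (\<lambda>\<omega>. (X i \<omega>)\<^sup>2))"
proof -
  have pair: "integrable M (\<lambda>\<omega>. X i \<omega> * X j \<omega>)
      \<and> expectation (\<lambda>\<omega>. X i \<omega> * X j \<omega>) = (if i = j then expectation (\<lambda>\<omega>. (X i \<omega>)\<^sup>2) else 0)"
    if "i \<in> I" "j \<in> I" for i j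
  proof (cases "i = j")
    case True
    then show ?thesis using sq[OF that(1)] by (simp add: power2_eq_square)
  next
    case False
    have "indep_vars (\<lambda>_. borel) X {i, j}"
      by (rule indep_vars_subset[OF ind]) (use that in auto)
    then show ?thesis
      using indep_vars_lebesgue_integral[of "{i, j}" X] indep_vars_integrable[of "{i, j}" X]
        False int that mean by auto
  qed
  have eq: "(\<Sum>i\<in>I. X i \<omega>)\<^sup>2 = (\<Sum>i\<in>I. \<Sum>j\<in>I. X i \<omega> * X j \<omega>)" for \<omega>
    by (simp add: power2_eq_square sum_product)
  show "integrable M (\<lambda>\<omega>. (\<Sum>i\<in>I. X i \<omega>)\<^sup>2)"
    unfolding eq using pair by (intro Bochner_Integration.integrable_sum) auto
  show "expectation (\<lambda>\<omega>. (\<Sum>i\<in>I. X i \<omega>)\<^sup>2) = (\<Sum>i\<in>I. expectation (\<lambda>\<omega>. (X i \<omega>)\<^sup>2))"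
    unfolding eq using pair fin
    by (subst Bochner_Integration.integral_sum, force)
      (auto intro!: sum.cong simp: Bochner_Integration.integral_sum sum.delta)
qed

lemma norm_square_eq_sum_Basis:
  fixes v :: "'b::euclidean_space"
  shows "(norm v)\<^sup>2 = (\<Sum>b\<in>Basis. (v \<bullet> b)\<^sup>2)"
  unfolding power2_norm_eq_inner by (subst euclidean_inner) (simp add: power2_eq_square)

text \<open>The scalar identity is applied in each coordinate. The mean square of the sum grows
  linearly in the number of summands, and averaging divides by the square of that number.\<close>

lemma (in prob_space) mean_square_average:
  fixes Y :: "'i \<Rightarrow> 'a \<Rightarrow> 'b::euclidean_space"
  assumes I: "finite I" "I \<noteq> {}" and ind: "indep_vars (\<lambda>_. borel) Y I"
    and C: "\<And>i. i \<in> I \<Longrightarrow> (\<integral>\<^sup>+\<omega>. ennreal ((norm (Y i \<omega>))\<^sup>2) \<partial>M) \<le> ennreal C" and C0: "0 \<le> C"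
    and mean: "\<And>i b. i \<in> I \<Longrightarrow> expectation (\<lambda>\<omega>. Y i \<omega> \<bullet> b) = 0"
  shows "(\<integral>\<^sup>+\<omega>. ennreal ((norm ((1 / real (card I)) *\<^sub>R (\<Sum>i\<in>I. Y i \<omega>)))\<^sup>2) \<partial>M) \<le> ennreal (C / real (card I))"
proof -
  define n where "n = real (card I)"
  have n: "n > 0" using I by (simp add: n_def card_gt_0_iff)
  have Y [measurable]: "Y i \<in> borel_measurable M" if "i \<in> I" for i
    using ind that by (simp add: indep_vars_def)
  have normint: "integrable M (\<lambda>\<omega>. (norm (Y i \<omega>))\<^sup>2)" "expectation (\<lambda>\<omega>. (norm (Y i \<omega>))\<^sup>2) \<le> C"
    if "i \<in> I" for i
  proof -
    have "(\<lambda>\<omega>. norm (Y i \<omega>)) \<in> borel_measurable M"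
      using Y[OF that] by measurable
    from integrable_if_square_bounded[OF this C[OF that]] C0
    show "integrable M (\<lambda>\<omega>. (norm (Y i \<omega>))\<^sup>2)" "expectation (\<lambda>\<omega>. (norm (Y i \<omega>))\<^sup>2) \<le> C"
      by blast+
  qed
  have comp: "integrable M (\<lambda>\<omega>. Y i \<omega> \<bullet> b)" "integrable M (\<lambda>\<omega>. (Y i \<omega> \<bullet> b)\<^sup>2)"
    if "i \<in> I" "b \<in> Basis" for i b
  proof -
    have "(\<integral>\<^sup>+\<omega>. ennreal ((Y i \<omega> \<bullet> b)\<^sup>2) \<partial>M) \<le> (\<integral>\<^sup>+\<omega>. ennreal ((norm (Y i \<omega>))\<^sup>2) \<partial>M)"
      using Basis_le_norm[OF that(2)] by (intro nn_integral_mono ennreal_leI) (simp flip: abs_le_square_iff)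
    also note C[OF that(1)]
    finally have le: "(\<integral>\<^sup>+\<omega>. ennreal ((Y i \<omega> \<bullet> b)\<^sup>2) \<partial>M) \<le> ennreal C" .
    have "(\<lambda>\<omega>. Y i \<omega> \<bullet> b) \<in> borel_measurable M"
      using Y[OF that(1)] by measurable
    from integrable_if_square_bounded(2,1)[OF this le]
    show "integrable M (\<lambda>\<omega>. Y i \<omega> \<bullet> b)" "integrable M (\<lambda>\<omega>. (Y i \<omega> \<bullet> b)\<^sup>2)" .
  qed
  have "indep_vars (\<lambda>_. borel) (\<lambda>i \<omega>. Y i \<omega> \<bullet> b) I" for b
    by (rule indep_vars_compose2[OF ind, where Y = "\<lambda>_ y. y \<bullet> b"]) simp
  note sq = expectation_square_sum_indep[OF I(1) this comp mean]
  have eq: "(norm ((1 / n) *\<^sub>R (\<Sum>i\<in>I. Y i \<omega>)))\<^sup>2 = (1 / n)\<^sup>2 * (\<Sum>b\<in>Basis. (\<Sum>i\<in>I. Y i \<omega> \<bullet> b)\<^sup>2)" for \<omega>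
    by (simp add: norm_square_eq_sum_Basis inner_sum_left sum_distrib_left power_mult_distrib power_divide
        flip: sum_divide_distrib)
  have "integrable M (\<lambda>\<omega>. (norm ((1 / n) *\<^sub>R (\<Sum>i\<in>I. Y i \<omega>)))\<^sup>2)"
    unfolding eq using sq(1) by (intro integrable_mult_right Bochner_Integration.integrable_sum) auto
  then have "(\<integral>\<^sup>+\<omega>. ennreal ((norm ((1 / n) *\<^sub>R (\<Sum>i\<in>I. Y i \<omega>)))\<^sup>2) \<partial>M)
      = ennreal (expectation (\<lambda>\<omega>. (norm ((1 / n) *\<^sub>R (\<Sum>i\<in>I. Y i \<omega>)))\<^sup>2))"
    by (intro nn_integral_eq_integral) auto
  also have "expectation (\<lambda>\<omega>. (norm ((1 / n) *\<^sub>R (\<Sum>i\<in>I. Y i \<omega>)))\<^sup>2)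
      = (1 / n)\<^sup>2 * (\<Sum>b\<in>Basis. \<Sum>i\<in>I. expectation (\<lambda>\<omega>. (Y i \<omega> \<bullet> b)\<^sup>2))"
    unfolding eq using sq by (simp add: Bochner_Integration.integral_sum)
  also have "(\<Sum>b\<in>Basis. \<Sum>i\<in>I. expectation (\<lambda>\<omega>. (Y i \<omega> \<bullet> b)\<^sup>2)) = (\<Sum>i\<in>I. expectation (\<lambda>\<omega>. (norm (Y i \<omega>))\<^sup>2))"
    using comp by (subst sum.swap) (auto simp: norm_square_eq_sum_Basis Bochner_Integration.integral_sum intro!: sum.cong)
  also have "\<dots> \<le> n * C"
    using sum_bounded_above[of I "\<lambda>i. expectation (\<lambda>\<omega>. (norm (Y i \<omega>))\<^sup>2)" C] normint by (simp add: n_def)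
  finally show ?thesis
    using n by (simp add: n_def power2_eq_square field_simps ennreal_leI)
qed

text \<open>If the squared norm reaches \<open>t\<close>, some coordinate of the average has square
  at least \<open>t / d\<close>, so the coordinate sum reaches \<open>\<epsilon>\<close>.
  Hoeffding's inequality in each coordinate and a union bound produce the dimension factor.\<close>

lemma (in prob_space) Hoeffding_average:
  fixes Y :: "'i \<Rightarrow> 'a \<Rightarrow> 'b::euclidean_space"
  assumes I: "finite I" "I \<noteq> {}" and ind: "indep_vars (\<lambda>_. borel) Y I"
    and bounded: "\<And>b. b \<in> Basis \<Longrightarrow> \<exists>a. \<forall>i\<in>I. \<forall>\<omega>\<in>space M. Y i \<omega> \<bullet> b \<in> {a..a + D}" and D: "0 < D"
    and mean: "\<And>i b. i \<in> I \<Longrightarrow> expectation (\<lambda>\<omega>. Y i \<omega> \<bullet> b) = 0"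
    and t: "0 \<le> t"
  shows "prob {\<omega> \<in> space M. t \<le> (norm ((1 / real (card I)) *\<^sub>R (\<Sum>i\<in>I. Y i \<omega>)))\<^sup>2}
    \<le> 2 * real DIM('b) * exp (- (2 / (real DIM('b) * D\<^sup>2)) * (real (card I) * t))"
proof -
  define n where "n = real (card I)"
  define d where "d = real DIM('b)"
  define \<epsilon> where "\<epsilon> = n * sqrt (t / d)"
  have n: "n > 0" using I by (simp add: n_def card_gt_0_iff)
  have d: "d > 0" by (simp add: d_def)
  have Y [measurable]: "Y i \<in> borel_measurable M" if "i \<in> I" for i
    using ind that by (simp add: indep_vars_def)
  define E where "E b = {\<omega> \<in> space M. \<epsilon> \<le> \<bar>\<Sum>i\<in>I. Y i \<omega> \<bullet> b\<bar>}" for b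
  have E [measurable]: "E b \<in> events" for b
    unfolding E_def by measurable
  have tail: "prob (E b) \<le> 2 * exp (- (2 / (d * D\<^sup>2)) * (n * t))" if b: "b \<in> Basis" for b
  proof -
    obtain a where a: "\<forall>i\<in>I. \<forall>\<omega>\<in>space M. Y i \<omega> \<bullet> b \<in> {a..a + D}"
      using bounded[OF b] by blast
    have indb: "indep_vars (\<lambda>_. borel) (\<lambda>i \<omega>. Y i \<omega> \<bullet> b) I"
      by (rule indep_vars_compose2[OF ind, where Y = "\<lambda>_ y. y \<bullet> b"]) simp
    interpret Hoeffding_ineq M I "\<lambda>i \<omega>. Y i \<omega> \<bullet> b" "\<lambda>_. a" "\<lambda>_. a + D" "\<Sum>i\<in>I. expectation (\<lambda>\<omega>. Y i \<omega> \<bullet> b)"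
      by unfold_locales (use I indb a in auto)
    have "0 \<le> \<epsilon>" using n d t by (simp add: \<epsilon>_def)
    moreover have "0 < (\<Sum>i\<in>I. (a + D - a)\<^sup>2)"
      using n D by (simp add: n_def)
    ultimately have "prob {\<omega> \<in> space M. \<epsilon> \<le> \<bar>(\<Sum>i\<in>I. Y i \<omega> \<bullet> b) - (\<Sum>i\<in>I. expectation (\<lambda>\<omega>. Y i \<omega> \<bullet> b))\<bar>}
        \<le> 2 * exp (-2 * \<epsilon>\<^sup>2 / (\<Sum>i\<in>I. (a + D - a)\<^sup>2))"
      by (rule Hoeffding_ineq_abs_ge)
    moreover have "-2 * \<epsilon>\<^sup>2 / (\<Sum>i\<in>I. (a + D - a)\<^sup>2) = - (2 / (d * D\<^sup>2)) * (n * t)"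
      using n d D t by (simp add: \<epsilon>_def power_mult_distrib flip: n_def) (simp add: field_simps power2_eq_square)
    ultimately show ?thesis
      using mean by (simp add: E_def)
  qed
  have "{\<omega> \<in> space M. t \<le> (norm ((1 / n) *\<^sub>R (\<Sum>i\<in>I. Y i \<omega>)))\<^sup>2} \<subseteq> (\<Union>b\<in>Basis. E b)"
  proof (rule subsetI, rule ccontr)
    fix \<omega> assume \<omega>: "\<omega> \<in> {\<omega> \<in> space M. t \<le> (norm ((1 / n) *\<^sub>R (\<Sum>i\<in>I. Y i \<omega>)))\<^sup>2}"
      and "\<omega> \<notin> (\<Union>b\<in>Basis. E b)"
    then have lt: "\<bar>\<Sum>i\<in>I. Y i \<omega> \<bullet> b\<bar> < \<epsilon>" if "b \<in> Basis" for b
      using that by (auto simp: E_def)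
    have "(norm ((1 / n) *\<^sub>R (\<Sum>i\<in>I. Y i \<omega>)))\<^sup>2 = (\<Sum>b\<in>Basis. (((\<Sum>i\<in>I. Y i \<omega> \<bullet> b)) / n)\<^sup>2)"
      unfolding norm_square_eq_sum_Basis by (simp add: inner_sum_left)
    also have "\<dots> < (\<Sum>b\<in>(Basis :: 'b set). t / d)"
    proof (rule sum_strict_mono)
      fix b :: 'b assume "b \<in> Basis"
      have "((\<Sum>i\<in>I. Y i \<omega> \<bullet> b) / n)\<^sup>2 = \<bar>(\<Sum>i\<in>I. Y i \<omega> \<bullet> b) / n\<bar>\<^sup>2"
        by (rule power2_abs[symmetric])
      also have "\<dots> < (sqrt (t / d))\<^sup>2"
        using lt[OF \<open>b \<in> Basis\<close>] n by (intro power_strict_mono) (auto simp: \<epsilon>_def field_simps)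
      also have "\<dots> = t / d" using t d by simp
      finally show "((\<Sum>i\<in>I. Y i \<omega> \<bullet> b) / n)\<^sup>2 < t / d" .
    qed auto
    also have "\<dots> = t" by (simp add: d_def)
    finally show False using \<omega> by simp
  qed
  then have "prob {\<omega> \<in> space M. t \<le> (norm ((1 / n) *\<^sub>R (\<Sum>i\<in>I. Y i \<omega>)))\<^sup>2} \<le> prob (\<Union>b\<in>Basis. E b)"
    by (intro finite_measure_mono) auto
  also have "\<dots> \<le> (\<Sum>b\<in>Basis. prob (E b))"
    by (intro finite_measure_subadditive_finite) auto
  also have "\<dots> \<le> (\<Sum>b\<in>(Basis :: 'b set). 2 * exp (- (2 / (d * D\<^sup>2)) * (n * t)))"
    by (intro sum_mono tail)
  finally show ?thesis by (simp add: n_def d_def)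
qed

subsection \<open>Geometric sums\<close>

text \<open>Multiplication by \<open>\<gamma> - r\<close> telescopes the sum to
  \<open>\<gamma> ^ k - r ^ k\<close>.\<close>

lemma geometric_convolution_le:
  fixes r \<gamma> :: real
  assumes "0 \<le> r" "r < \<gamma>"
  shows "(\<Sum>j<k. r ^ (k - Suc j) * \<gamma> ^ j) \<le> \<gamma> ^ k / (\<gamma> - r)"
proof -
  have "(\<gamma> - r) * (\<Sum>j<k. r ^ (k - Suc j) * \<gamma> ^ j) = \<gamma> ^ k - r ^ k"
    by (rule power_diff_sumr2[symmetric])
  also have "\<dots> \<le> \<gamma> ^ k" using assms by simp
  finally show ?thesis using assms by (simp add: field_simps)
qed

text \<open>Bernoulli's inequality makes the exponents grow at least linearly, and
  \<open>1 \<le> y\<close> makes the slope independent of \<open>y\<close>; a geometric series then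
  bounds the sum uniformly in \<open>k\<close>.\<close>

lemma sum_exp_growing_le:
  fixes s y :: real
  assumes s: "0 < s" "s < 1" and y: "1 \<le> y"
  shows "(\<Sum>i<k. exp (- y * (1 / s) ^ i)) \<le> exp (- y) / (1 - exp (- (1 / s - 1)))"
proof -
  define \<delta> where "\<delta> = 1 / s - 1"
  have \<delta>: "\<delta> > 0" using s by (simp add: \<delta>_def field_simps)
  have "exp (- y * (1 / s) ^ i) \<le> exp (- y) * exp (- \<delta>) ^ i" for i
  proof -
    have "1 + real i * \<delta> \<le> (1 + \<delta>) ^ i"
      by (rule Bernoulli_inequality) (use \<delta> in simp)
    then have "y * (1 + real i * \<delta>) \<le> y * (1 / s) ^ i"
      using y by (intro mult_left_mono) (auto simp: \<delta>_def)
    moreover have "real i * \<delta> \<le> y * (real i * \<delta>)"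
      using mult_right_mono[OF y, of "real i * \<delta>"] \<delta> by simp
    ultimately have "- y * (1 / s) ^ i \<le> - y + real i * (- \<delta>)"
      by (simp add: algebra_simps)
    then have "exp (- y * (1 / s) ^ i) \<le> exp (- y + real i * (- \<delta>))" by simp
    also have "\<dots> = exp (- y) * exp (- \<delta>) ^ i"
      by (simp only: exp_add exp_of_nat_mult)
    finally show ?thesis .
  qed
  then have "(\<Sum>i<k. exp (- y * (1 / s) ^ i)) \<le> exp (- y) * (\<Sum>i<k. exp (- \<delta>) ^ i)"
    unfolding sum_distrib_left by (rule sum_mono)
  also have "(\<Sum>i<k. exp (- \<delta>) ^ i) \<le> 1 / (1 - exp (- \<delta>))"
    using \<delta> by (simp add: sum_gp_strict divide_right_mono)
  finally show ?thesis by (simp add: \<delta>_def)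
qed

text \<open>Splits the level \<open>a\<close> geometrically over the summands, so that the tails of the individual
  summands remain summable.\<close>
lemma geometric_sum_large_summand:
  fixes s a :: real and v :: "nat \<Rightarrow> real"
  assumes s: "0 \<le> s" "s < 1" and a: "0 < a" and le: "a \<le> (\<Sum>j<k. v j)"
  shows "\<exists>j<k. a * (1 - s) * s ^ (k - Suc j) \<le> v j"
proof (rule ccontr)
  assume "\<not> ?thesis"
  then have lt: "v j < a * (1 - s) * s ^ (k - Suc j)" if "j < k" for j
    using that by force
  have "k > 0" using a le by (cases k) auto
  then have "(\<Sum>j<k. v j) < (\<Sum>j<k. a * (1 - s) * s ^ (k - Suc j))"
    by (intro sum_strict_mono lt) auto
  also have "\<dots> = a * (1 - s) * (\<Sum>j<k. s ^ (k - Suc j) * 1 ^ j)"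
    by (simp add: sum_distrib_left)
  also have "\<dots> \<le> a * (1 - s) * (1 ^ k / (1 - s))"
    using s a by (intro mult_left_mono geometric_convolution_le) auto
  also have "\<dots> = a" using s by simp
  finally show False using le by simp
qed

subsection \<open>The sampled proximal gradient iteration\<close>

locale sampled_prox_gradient =
  composite_problem f gradf g h L + prob_space M
  for f :: "'a::euclidean_space \<Rightarrow> real" and gradf g h L and M :: "'w measure" +
  fixes \<tau> :: real
    and N :: "'z measure" and Z :: "'w \<Rightarrow> 'z" and F :: "'a \<Rightarrow> 'z \<Rightarrow> real"
    and gradF :: "'a \<Rightarrow> 'z \<Rightarrow> 'a"
    and m :: "nat \<Rightarrow> nat" and Zs :: "nat \<Rightarrow> nat \<Rightarrow> 'w \<Rightarrow> 'z"
    and x0 :: 'a and x e :: "nat \<Rightarrow> 'w \<Rightarrow> 'a"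
  assumes \<tau>_ge: "1 \<le> \<tau>"
    and error_bound: "\<And>u. infdist u (argmin_set h)
                         \<le> \<tau> * norm (u - prox g (1 / L) (u - (1 / L) *\<^sub>R gradf u))"
    and Z [measurable]: "Z \<in> measurable M N"
    and F_measurable [measurable]: "\<And>u. F u \<in> borel_measurable N"
    and F_integrable: "\<And>u. integrable M (\<lambda>\<omega>. F u (Z \<omega>))"
    and f_eq: "\<And>u. f u = (\<integral>\<omega>. F u (Z \<omega>) \<partial>M)"
    and gradF: "\<And>u z. z \<in> space N \<Longrightarrow> GDERIV (\<lambda>v. F v z) u :> gradF u z"
    and Zs_indep: "indep_vars (\<lambda>_. N) (\<lambda>(k, i). Zs k i) (SIGMA k:UNIV. {1..m k})"
    and Zs_copies: "\<And>k i. i \<in> {1..m k} \<Longrightarrow> distr M N (Zs k i) = distr M N Z"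
    and m_pos: "\<And>k. 1 \<le> m k"
    and x0: "h x0 < \<infinity>"
    and x_0: "\<And>\<omega>. \<omega> \<in> space M \<Longrightarrow> x 0 \<omega> = x0"
    and direction: "\<And>k \<omega>. \<omega> \<in> space M \<Longrightarrow>
        gradf (x k \<omega>) + e k \<omega> = (1 / real (m k)) *\<^sub>R (\<Sum>i=1..m k. gradF (x k \<omega>) (Zs k i \<omega>))"
    and x_Suc: "\<And>k \<omega>. \<omega> \<in> space M \<Longrightarrow>
        x (Suc k) \<omega> = prox g (1 / L) (x k \<omega> - (1 / L) *\<^sub>R (gradf (x k \<omega>) + e k \<omega>))"
begin

definition rate :: real where
  "rate = 8 * \<tau>\<^sup>2 / (1 + 8 * \<tau>\<^sup>2)"

lemma rate_pos: "0 < rate"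
proof -
  have "0 < \<tau>\<^sup>2" using \<tau>_ge by simp
  then show ?thesis unfolding rate_def by (intro divide_pos_pos add_pos_pos) auto
qed

lemma x_dom: "\<omega> \<in> space M \<Longrightarrow> g (x k \<omega>) < \<infinity>"
  by (cases k) (simp_all only: x_0 x_Suc prox_dom g_finite_if_h_finite[OF x0])

text \<open>Iterating \<open>opt_gap_step\<close> along each path: the error made at step
  \<open>j\<close> is damped by the \<open>k - Suc j\<close> contractions that follow it.\<close>

lemma opt_gap_recurrence:
  assumes \<omega>: "\<omega> \<in> space M"
  shows "opt_gap h (x k \<omega>) \<le> rate ^ k * opt_gap h x0
    + 2 / L * (\<Sum>j<k. rate ^ (k - Suc j) * (norm (e j \<omega>))\<^sup>2)"
proof (induction k)
  case 0
  then show ?case by (simp add: x_0[OF \<omega>])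
next
  case (Suc k)
  have "opt_gap h (x (Suc k) \<omega>) \<le> rate * opt_gap h (x k \<omega>) + 2 / L * (norm (e k \<omega>))\<^sup>2"
    unfolding x_Suc[OF \<omega>] rate_def by (rule opt_gap_step[OF \<tau>_ge error_bound x_dom[OF \<omega>]])
  also have "\<dots> \<le> rate * (rate ^ k * opt_gap h x0
      + 2 / L * (\<Sum>j<k. rate ^ (k - Suc j) * (norm (e j \<omega>))\<^sup>2)) + 2 / L * (norm (e k \<omega>))\<^sup>2"
    using rate_pos by (intro add_right_mono mult_left_mono Suc) auto
  also have "\<dots> = rate ^ Suc k * opt_gap h x0
      + 2 / L * (rate * (\<Sum>j<k. rate ^ (k - Suc j) * (norm (e j \<omega>))\<^sup>2) + (norm (e k \<omega>))\<^sup>2)"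
    by (simp add: algebra_simps)
  also have "rate * (\<Sum>j<k. rate ^ (k - Suc j) * (norm (e j \<omega>))\<^sup>2)
      = (\<Sum>j<k. rate ^ (Suc k - Suc j) * (norm (e j \<omega>))\<^sup>2)"
    unfolding sum_distrib_left
    by (intro sum.cong) (simp_all add: Suc_diff_Suc[symmetric] mult.assoc flip: power_Suc)
  finally show ?case by simp
qed

section \<open>Measurability of the iterates and their dependence on earlier samples\<close>

lemma gradF_measurable [measurable]: "(\<lambda>(u, z). gradF u z) \<in> borel_measurable (borel \<Otimes>\<^sub>M N)"
  by (rule borel_measurable_gradient[OF F_measurable gradF])

lemma gradF_measurable2 [measurable (raw)]:
  assumes "p \<in> borel_measurable K" "q \<in> measurable K N"
  shows "(\<lambda>w. gradF (p w) (q w)) \<in> borel_measurable K"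
  using measurable_compose[OF measurable_Pair[OF assms] gradF_measurable] by simp

lemma prox_measurable [measurable]: "prox g (1 / L) \<in> borel_measurable borel"
  by (rule borel_measurable_continuous_onI[OF continuous_prox])

lemma gradf_measurable [measurable]: "gradf \<in> borel_measurable borel"
  by (rule borel_measurable_continuous_onI[OF continuous_gradf])

lemma Zs_measurable [measurable]: "i \<in> {1..m k} \<Longrightarrow> Zs k i \<in> measurable M N"
  using Zs_indep unfolding indep_vars_def by fastforce

text \<open>A block of samples as one random point of a product space; \<open>restrict\<close>
  places it in the space of \<open>PiM\<close>.\<close>

definition samples :: "(nat \<times> nat) set \<Rightarrow> 'w \<Rightarrow> nat \<times> nat \<Rightarrow> 'z" where
  "samples I \<omega> = restrict (\<lambda>(k, i). Zs k i \<omega>) I"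

lemma samples_measurable:
  "I \<subseteq> (SIGMA k:UNIV. {1..m k}) \<Longrightarrow> samples I \<in> measurable M (PiM I (\<lambda>_. N))"
  unfolding samples_def[abs_def] by (rule measurable_restrict) auto

text \<open>Only samples of steps before \<open>k\<close> enter, which is the source of independence
  between the iterate and the samples of step \<open>k\<close>.\<close>

lemma x_factors:
  "\<exists>H \<in> borel_measurable (PiM (SIGMA j:{..<k}. {1..m j}) (\<lambda>_. N)).
     \<forall>\<omega>\<in>space M. x k \<omega> = H (samples (SIGMA j:{..<k}. {1..m j}) \<omega>)"
proof (induction k)
  case 0
  show ?case by (rule bexI[of _ "\<lambda>_. x0"]) (auto simp: x_0)
next
  case (Suc k)
  define A where "A k = (SIGMA j:{..<k}. {1..m j})" for k
  obtain H where [measurable]: "H \<in> borel_measurable (PiM (A k) (\<lambda>_. N))"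
    and H: "\<And>\<omega>. \<omega> \<in> space M \<Longrightarrow> x k \<omega> = H (samples (A k) \<omega>)"
    using Suc unfolding A_def by blast
  have sub: "A k \<subseteq> A (Suc k)" by (auto simp: A_def)
  \<comment> \<open>One step of the algorithm: the past is recovered by restriction, the fresh
    samples by evaluation at the indices \<open>(k, i)\<close>.\<close>
  define H' where "H' w = prox g (1 / L) (H (restrict w (A k))
      - (1 / L) *\<^sub>R (1 / real (m k)) *\<^sub>R (\<Sum>i=1..m k. gradF (H (restrict w (A k))) (w (k, i))))" for w
  have [measurable]: "(\<lambda>w. restrict w (A k)) \<in> measurable (PiM (A (Suc k)) (\<lambda>_. N)) (PiM (A k) (\<lambda>_. N))"
    by (rule measurable_restrict_subset[OF sub])
  have [measurable]: "(\<lambda>w. w (k, i)) \<in> measurable (PiM (A (Suc k)) (\<lambda>_. N)) N" if "i \<in> {1..m k}" for i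
    by (rule measurable_component_singleton) (use that in \<open>auto simp: A_def\<close>)
  have "H' \<in> borel_measurable (PiM (A (Suc k)) (\<lambda>_. N))"
    unfolding H'_def by measurable
  moreover have "x (Suc k) \<omega> = H' (samples (A (Suc k)) \<omega>)" if \<omega>: "\<omega> \<in> space M" for \<omega>
  proof -
    have "restrict (samples (A (Suc k)) \<omega>) (A k) = samples (A k) \<omega>"
      using sub by (simp add: samples_def Int_absorb1)
    moreover have "samples (A (Suc k)) \<omega> (k, i) = Zs k i \<omega>" if "i \<in> {1..m k}" for i
      using that by (simp add: samples_def A_def)
    ultimately show ?thesis
      unfolding H'_def x_Suc[OF \<omega>] direction[OF \<omega>] by (simp add: H[OF \<omega>])
  qed
  ultimately show ?case unfolding A_def by blast
qed

lemma x_measurable [measurable]: "x k \<in> borel_measurable M"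
proof -
  define A where "A = (SIGMA j:{..<k}. {1..m j})"
  obtain H where [measurable]: "H \<in> borel_measurable (PiM A (\<lambda>_. N))"
    and H: "\<And>\<omega>. \<omega> \<in> space M \<Longrightarrow> x k \<omega> = H (samples A \<omega>)"
    using x_factors[of k] unfolding A_def by blast
  have [measurable]: "samples A \<in> measurable M (PiM A (\<lambda>_. N))"
    by (rule samples_measurable) (auto simp: A_def)
  have "(\<lambda>\<omega>. H (samples A \<omega>)) \<in> borel_measurable M" by measurable
  then show ?thesis by (subst measurable_cong[OF H])
qed

lemma opt_gap_measurable: "(\<lambda>\<omega>. opt_gap h (x k \<omega>)) \<in> borel_measurable M"
  using borel_measurable_opt_gap by measurable

section \<open>The gradient error at a frozen point\<close>

text \<open>The error with the random iterate replaced by a fixed \<open>u\<close>. The sum runs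
  over pairs to match the index set on which the samples are independent.\<close>

definition error_at :: "nat \<Rightarrow> 'a \<Rightarrow> 'w \<Rightarrow> 'a" where
  "error_at k u \<omega> = (1 / real (m k)) *\<^sub>R (\<Sum>p\<in>{k} \<times> {1..m k}. gradF u ((\<lambda>(k, i). Zs k i) p \<omega>) - gradf u)"

lemma error_at_eq: "error_at k u \<omega> = (1 / real (m k)) *\<^sub>R (\<Sum>i=1..m k. gradF u (Zs k i \<omega>)) - gradf u"
proof -
  have "(\<Sum>p\<in>{k} \<times> {1..m k}. gradF u ((\<lambda>(k, i). Zs k i) p \<omega>) - gradf u)
    = (\<Sum>i=1..m k. gradF u (Zs k i \<omega>) - gradf u)"
    by (rule sum.reindex_bij_witness[of _ "\<lambda>i. (k, i)" snd]) auto
  then show ?thesis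
    using m_pos[of k] by (simp add: error_at_def sum_subtractf scaleR_right_diff_distrib sum_constant_scaleR)
qed

lemma e_eq: "\<omega> \<in> space M \<Longrightarrow> e k \<omega> = error_at k (x k \<omega>) \<omega>"
  using direction[of \<omega> k] by (simp add: error_at_eq algebra_simps)

lemma e_measurable [measurable]: "e k \<in> borel_measurable M"
proof -
  have "(\<lambda>\<omega>. error_at k (x k \<omega>) \<omega>) \<in> borel_measurable M"
    unfolding error_at_eq by measurable
  then show ?thesis by (subst measurable_cong[OF e_eq])
qed

text \<open>The iterate \<^term>\<open>x k\<close> is independent of the samples drawn at iteration \<^term>\<open>k\<close>, so it
  may be frozen when bounding the error.\<close>
lemma error_nn_integral_le:
  assumes [measurable]: "\<psi> \<in> borel_measurable borel"
    and le: "\<And>u. (\<integral>\<^sup>+\<omega>. \<psi> (error_at k u \<omega>) \<partial>M) \<le> C"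
  shows "(\<integral>\<^sup>+\<omega>. \<psi> (e k \<omega>) \<partial>M) \<le> C"
proof -
  define A where "A = (SIGMA j:{..<k}. {1..m j})"
  define B where "B = {k} \<times> {1..m k}"
  obtain H where H [measurable]: "H \<in> borel_measurable (PiM A (\<lambda>_. N))"
    and xH: "\<And>\<omega>. \<omega> \<in> space M \<Longrightarrow> x k \<omega> = H (samples A \<omega>)"
    using x_factors[of k] unfolding A_def by blast
  \<comment> \<open>The blocks \<open>A\<close> of earlier steps and \<open>B\<close> of step
    \<open>k\<close> are disjoint.\<close>
  have ind: "indep_var (PiM A (\<lambda>_. N)) (samples A) (PiM B (\<lambda>_. N)) (samples B)"
    unfolding samples_def[abs_def]
    using indep_var_restrict[OF Zs_indep, of A B]
    by (auto simp: A_def B_def case_prod_beta' cong: restrict_cong)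
  define \<phi> where "\<phi> p = \<psi> ((1 / real (m k)) *\<^sub>R (\<Sum>i=1..m k. gradF (fst p) (snd p (k, i))) - gradf (fst p))"
    for p :: "'a \<times> (nat \<times> nat \<Rightarrow> 'z)"
  have [measurable]: "(\<lambda>w. w (k, i)) \<in> measurable (PiM B (\<lambda>_. N)) N" if "i \<in> {1..m k}" for i
    by (rule measurable_component_singleton) (use that in \<open>auto simp: B_def\<close>)
  have "\<phi> \<in> borel_measurable (borel \<Otimes>\<^sub>M PiM B (\<lambda>_. N))"
    unfolding \<phi>_def by measurable
  moreover have \<phi>: "\<phi> (u, samples B \<omega>) = \<psi> (error_at k u \<omega>)" for u \<omega>
    unfolding \<phi>_def error_at_eq by (simp add: samples_def B_def)
  ultimately have "(\<integral>\<^sup>+\<omega>. \<phi> (H (samples A \<omega>), samples B \<omega>) \<partial>M) \<le> C"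
    using le nn_integral_indep_var_le[OF ind, of "\<lambda>p. \<phi> (H (fst p), snd p)" C] by simp
  moreover have "(\<integral>\<^sup>+\<omega>. \<psi> (e k \<omega>) \<partial>M) = (\<integral>\<^sup>+\<omega>. \<phi> (H (samples A \<omega>), samples B \<omega>) \<partial>M)"
    by (intro nn_integral_cong) (simp add: \<phi> e_eq xH)
  ultimately show ?thesis by simp
qed

lemma indep_sampled_gradients:
  "indep_vars (\<lambda>_. borel) (\<lambda>p \<omega>. gradF u ((\<lambda>(k, i). Zs k i) p \<omega>) - gradf u) ({k} \<times> {1..m k})"
proof -
  have "indep_vars (\<lambda>_. N) (\<lambda>(k, i). Zs k i) ({k} \<times> {1..m k})"
    by (rule indep_vars_subset[OF Zs_indep]) auto
  then show ?thesis
    by (rule indep_vars_compose2[where Y = "\<lambda>_ z. gradF u z - gradf u"]) measurable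
qed

section \<open>Unbiased sampling, mean square and tail of the error\<close>

text \<open>Formulated for the law of \<open>Z\<close>, so that it transfers to every copy; inner
  products reduce it to scalar integrals.\<close>

definition unbiased :: bool where
  "unbiased \<longleftrightarrow> (\<forall>u b. integrable (distr M N Z) (\<lambda>z. gradF u z \<bullet> b)
     \<and> (\<integral>z. gradF u z \<bullet> b \<partial>distr M N Z) = gradf u \<bullet> b)"

lemma sampled_gradient_mean:
  assumes "unbiased" and i: "i \<in> {1..m k}"
  shows "expectation (\<lambda>\<omega>. (gradF u (Zs k i \<omega>) - gradf u) \<bullet> b) = 0"
proof -
  have [measurable]: "Zs k i \<in> measurable M N" using i by (rule Zs_measurable)
  have "integrable (distr M N (Zs k i)) (\<lambda>z. gradF u z \<bullet> b)"
    "(\<integral>z. gradF u z \<bullet> b \<partial>distr M N (Zs k i)) = gradf u \<bullet> b"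
    using assms unfolding unbiased_def Zs_copies[OF i] by auto
  then have "integrable M (\<lambda>\<omega>. gradF u (Zs k i \<omega>) \<bullet> b)"
    "expectation (\<lambda>\<omega>. gradF u (Zs k i \<omega>) \<bullet> b) = gradf u \<bullet> b"
    by (simp_all add: integrable_distr_eq integral_distr)
  then show ?thesis by (simp add: inner_diff_left prob_space)
qed

lemma distr_expectations:
  "prob_space (distr M N Z)" "integrable (distr M N Z) (F u)" "(\<integral>z. F u z \<partial>distr M N Z) = f u"
  by (auto intro: prob_space_distr simp: integrable_distr_eq F_integrable integral_distr f_eq)

text \<open>Apply \<open>expectation_gradient\<close> to \<open>F v z - f v\<close>: its gradient is
  bounded in mean square by hypothesis, and its expectation vanishes identically.\<close>

lemma unbiased_if_variance_bounded:
  assumes C: "\<And>u. (\<integral>\<^sup>+\<omega>. ennreal ((norm (gradF u (Z \<omega>) - gradf u))\<^sup>2) \<partial>M) \<le> ennreal C" and "0 \<le> C"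
  shows unbiased
  unfolding unbiased_def
proof (intro allI)
  fix u b
  interpret P: prob_space "distr M N Z" by (rule distr_expectations)
  have int: "integrable (distr M N Z) (\<lambda>z. F v z - f v)" for v
    using distr_expectations(2) by simp
  have mean: "P.expectation (\<lambda>z. F v z - f v) = 0" for v
    using distr_expectations(2,3)[of v] P.prob_space by simp
  have grad: "GDERIV (\<lambda>v. F v z - f v) v :> gradF v z - gradf v" if "z \<in> space (distr M N Z)" for v z
    using that by (intro GDERIV_diff gradF gradf) simp
  have var: "(\<integral>\<^sup>+z. ennreal ((norm (gradF v z - gradf v))\<^sup>2) \<partial>distr M N Z) \<le> ennreal C" for v
    using C[of v] by (subst nn_integral_distr) auto
  note * = P.expectation_gradient[OF int grad mean GDERIV_const var \<open>0 \<le> C\<close>, of u b]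
  have "integrable (distr M N Z) (\<lambda>z. (gradF u z - gradf u) \<bullet> b + gradf u \<bullet> b)"
    using *(1) by (intro Bochner_Integration.integrable_add) auto
  then have i: "integrable (distr M N Z) (\<lambda>z. gradF u z \<bullet> b)"
    by (simp add: inner_diff_left)
  with *(2) P.prob_space show "integrable (distr M N Z) (\<lambda>z. gradF u z \<bullet> b)
      \<and> P.expectation (\<lambda>z. gradF u z \<bullet> b) = gradf u \<bullet> b"
    by (simp add: inner_diff_left)
qed

lemma mean_square_error:
  assumes C: "\<And>u. (\<integral>\<^sup>+\<omega>. ennreal ((norm (gradF u (Z \<omega>) - gradf u))\<^sup>2) \<partial>M) \<le> ennreal C" and C0: "0 \<le> C"
  shows "integrable M (\<lambda>\<omega>. (norm (e k \<omega>))\<^sup>2)" "expectation (\<lambda>\<omega>. (norm (e k \<omega>))\<^sup>2) \<le> C / real (m k)"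
proof -
  have un: unbiased by (rule unbiased_if_variance_bounded[OF C C0])
  have "(\<integral>\<^sup>+\<omega>. ennreal ((norm (error_at k u \<omega>))\<^sup>2) \<partial>M) \<le> ennreal (C / real (m k))" for u
  proof -
    have "(\<integral>\<^sup>+\<omega>. ennreal ((norm (gradF u ((\<lambda>(k, i). Zs k i) p \<omega>) - gradf u))\<^sup>2) \<partial>M) \<le> ennreal C"
      if p: "p \<in> {k} \<times> {1..m k}" for p
    proof -
      obtain i where i: "i \<in> {1..m k}" "p = (k, i)" using p by blast
      have [measurable]: "Zs k i \<in> measurable M N" using i(1) by (rule Zs_measurable)
      have "(\<integral>\<^sup>+z. ennreal ((norm (gradF u z - gradf u))\<^sup>2) \<partial>distr M N (Zs k i)) \<le> ennreal C"
        unfolding Zs_copies[OF i(1)] using C[of u] by (subst nn_integral_distr) auto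
      then show ?thesis
        by (subst (asm) nn_integral_distr) (auto simp: i)
    qed
    moreover have "expectation (\<lambda>\<omega>. (gradF u ((\<lambda>(k, i). Zs k i) p \<omega>) - gradf u) \<bullet> b) = 0"
      if "p \<in> {k} \<times> {1..m k}" for p b
      using that sampled_gradient_mean[OF un] by auto
    ultimately show ?thesis
      using mean_square_average[OF _ _ indep_sampled_gradients _ C0, of k u] m_pos[of k]
      by (simp add: error_at_def)
  qed
  then have le: "(\<integral>\<^sup>+\<omega>. ennreal ((norm (e k \<omega>))\<^sup>2) \<partial>M) \<le> ennreal (C / real (m k))"
    by (intro error_nn_integral_le) auto
  have meas: "(\<lambda>\<omega>. norm (e k \<omega>)) \<in> borel_measurable M" by measurable
  show "integrable M (\<lambda>\<omega>. (norm (e k \<omega>))\<^sup>2)" "expectation (\<lambda>\<omega>. (norm (e k \<omega>))\<^sup>2) \<le> C / real (m k)"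
    using integrable_if_square_bounded(1,3)[OF meas le] C0 by auto
qed

text \<open>The diameter controls differences between samples, not yet the distance to
  \<open>gradf\<close>. So \<open>F\<close> is centred at a reference sample \<open>z0\<close>,
  which bounds the gradient pointwise.\<close>

lemma unbiased_if_diameter_bounded:
  assumes D: "\<And>u z z' b. z \<in> space N \<Longrightarrow> z' \<in> space N \<Longrightarrow> b \<in> Basis \<Longrightarrow> \<bar>(gradF u z - gradF u z') \<bullet> b\<bar> \<le> D"
  shows unbiased
  unfolding unbiased_def
proof (intro allI)
  fix u b
  interpret P: prob_space "distr M N Z" by (rule distr_expectations)
  obtain z0 where z0: "z0 \<in> space N" using P.not_empty by auto
  have int: "integrable (distr M N Z) (\<lambda>z. F v z - F v z0)" for v
    using distr_expectations(2) by simp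
  have mean: "P.expectation (\<lambda>z. F v z - F v z0) = f v - F v z0" for v
    using distr_expectations(2,3)[of v] P.prob_space by simp
  have grad: "GDERIV (\<lambda>v. F v z - F v z0) v :> gradF v z - gradF v z0" if "z \<in> space (distr M N Z)" for v z
    using that z0 by (intro GDERIV_diff gradF) simp_all
  have "(norm (gradF v z - gradF v z0))\<^sup>2 \<le> real DIM('a) * D\<^sup>2" if "z \<in> space N" for v z
  proof -
    have "(norm (gradF v z - gradF v z0))\<^sup>2 \<le> (\<Sum>b\<in>(Basis :: 'a set). D\<^sup>2)"
      unfolding norm_square_eq_sum_Basis
    proof (rule sum_mono)
      fix b :: 'a assume "b \<in> Basis"
      then have "\<bar>(gradF v z - gradF v z0) \<bullet> b\<bar>\<^sup>2 \<le> D\<^sup>2"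
        by (intro power_mono D that z0) auto
      then show "((gradF v z - gradF v z0) \<bullet> b)\<^sup>2 \<le> D\<^sup>2" by simp
    qed
    then show ?thesis by simp
  qed
  then have "(\<integral>\<^sup>+z. ennreal ((norm (gradF v z - gradF v z0))\<^sup>2) \<partial>distr M N Z)
      \<le> (\<integral>\<^sup>+z. ennreal (real DIM('a) * D\<^sup>2) \<partial>distr M N Z)" for v
    by (intro nn_integral_mono ennreal_leI) simp
  then have var: "(\<integral>\<^sup>+z. ennreal ((norm (gradF v z - gradF v z0))\<^sup>2) \<partial>distr M N Z)
      \<le> ennreal (real DIM('a) * D\<^sup>2)" for v
    using P.emeasure_space_1 by simp
  have "GDERIV (\<lambda>v. f v - F v z0) u :> gradf u - gradF u z0"
    by (intro GDERIV_diff gradF gradf z0)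
  note * = P.expectation_gradient[OF int grad mean this var, of b]
  have "integrable (distr M N Z) (\<lambda>z. (gradF u z - gradF u z0) \<bullet> b + gradF u z0 \<bullet> b)"
    using *(1) by (intro Bochner_Integration.integrable_add) auto
  then have i: "integrable (distr M N Z) (\<lambda>z. gradF u z \<bullet> b)"
    by (simp add: inner_diff_left)
  with *(2) P.prob_space show "integrable (distr M N Z) (\<lambda>z. gradF u z \<bullet> b)
      \<and> P.expectation (\<lambda>z. gradF u z \<bullet> b) = gradf u \<bullet> b"
    by (simp add: inner_diff_left)
qed

text \<open>Freezing the iterate works for nonnegative integrals, so the event is encoded by the
  indicator \<open>\<psi>\<close>; at a frozen point \<open>Hoeffding_average\<close>
  applies.\<close>

lemma error_tail:
  assumes D: "\<And>u z z' b. z \<in> space N \<Longrightarrow> z' \<in> space N \<Longrightarrow> b \<in> Basis \<Longrightarrow> \<bar>(gradF u z - gradF u z') \<bullet> b\<bar> \<le> D"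
    and D0: "0 < D" and t: "0 \<le> t"
  shows "prob {\<omega> \<in> space M. t \<le> (norm (e k \<omega>))\<^sup>2}
    \<le> 2 * real DIM('a) * exp (- (2 / (real DIM('a) * D\<^sup>2)) * (real (m k) * t))" (is "_ \<le> ?C")
proof -
  have un: unbiased by (rule unbiased_if_diameter_bounded[OF D])
  define \<psi> where "\<psi> v = (indicator {v. t \<le> (norm v)\<^sup>2} v :: ennreal)" for v :: 'a
  have "{v :: 'a. t \<le> (norm v)\<^sup>2} \<in> sets borel" by measurable
  then have \<psi>: "\<psi> \<in> borel_measurable borel" unfolding \<psi>_def by simp
  have emb: "(\<integral>\<^sup>+\<omega>. \<psi> (v \<omega>) \<partial>M) = ennreal (prob {\<omega> \<in> space M. t \<le> (norm (v \<omega>))\<^sup>2})"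
    if [measurable]: "v \<in> borel_measurable M" for v
  proof -
    have "(\<integral>\<^sup>+\<omega>. \<psi> (v \<omega>) \<partial>M) = (\<integral>\<^sup>+\<omega>. indicator {\<omega> \<in> space M. t \<le> (norm (v \<omega>))\<^sup>2} \<omega> \<partial>M)"
      by (intro nn_integral_cong) (auto simp: \<psi>_def indicator_def)
    also have "\<dots> = emeasure M {\<omega> \<in> space M. t \<le> (norm (v \<omega>))\<^sup>2}"
      by (rule nn_integral_indicator) measurable
    finally show ?thesis by (simp add: emeasure_eq_measure)
  qed
  obtain z0 where z0: "z0 \<in> space N"
    using not_empty measurable_space[OF Z] by blast
  have "(\<integral>\<^sup>+\<omega>. \<psi> (error_at k u \<omega>) \<partial>M) \<le> ennreal ?C" for u
  proof -
    let ?Y = "\<lambda>p \<omega>. gradF u ((\<lambda>(k, i). Zs k i) p \<omega>) - gradf u"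
    have bd: "\<exists>a. \<forall>p\<in>{k} \<times> {1..m k}. \<forall>\<omega>\<in>space M. ?Y p \<omega> \<bullet> b \<in> {a..a + D}" if b: "b \<in> Basis" for b
    proof -
      have bdd: "bdd_below ((\<lambda>z. gradF u z \<bullet> b) ` space N)"
      proof (rule bdd_belowI2)
        show "gradF u z0 \<bullet> b - D \<le> gradF u z \<bullet> b" if "z \<in> space N" for z
          using D[OF z0 that b, of u] by (simp add: inner_diff_left abs_le_iff)
      qed
      \<comment> \<open>From this infimum all values of the coordinate lie within \<open>D\<close>;
        the interval is then shifted by the mean.\<close>
      define a where "a = (INF z\<in>space N. gradF u z \<bullet> b)"
      have "a \<le> gradF u z \<bullet> b" if "z \<in> space N" for z
        unfolding a_def by (rule cINF_lower[OF bdd that])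
      moreover have "gradF u z \<bullet> b - D \<le> a" if "z \<in> space N" for z
        unfolding a_def
      proof (rule cINF_greatest)
        show "gradF u z \<bullet> b - D \<le> gradF u z' \<bullet> b" if "z' \<in> space N" for z'
          using D[OF \<open>z \<in> space N\<close> that b, of u] by (simp add: inner_diff_left abs_le_iff)
      qed (use z0 in auto)
      ultimately have *: "gradF u z \<bullet> b - gradf u \<bullet> b \<in> {a - gradf u \<bullet> b..a - gradf u \<bullet> b + D}"
        if "z \<in> space N" for z
        using that by fastforce
      have "?Y p \<omega> \<bullet> b \<in> {a - gradf u \<bullet> b..a - gradf u \<bullet> b + D}"
        if p: "p \<in> {k} \<times> {1..m k}" "\<omega> \<in> space M" for p \<omega>
      proof -
        obtain i where i: "i \<in> {1..m k}" "p = (k, i)" using p(1) by blast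
        show ?thesis
          using *[OF measurable_space[OF Zs_measurable[OF i(1)] p(2)]] by (simp add: i(2) inner_diff_left)
      qed
      then show ?thesis by blast
    qed
    have mean: "expectation (\<lambda>\<omega>. ?Y p \<omega> \<bullet> b) = 0" if "p \<in> {k} \<times> {1..m k}" for p b
      using that sampled_gradient_mean[OF un] by auto
    have "prob {\<omega> \<in> space M. t \<le> (norm (error_at k u \<omega>))\<^sup>2} \<le> ?C"
      using Hoeffding_average[OF _ _ indep_sampled_gradients bd D0 mean t] m_pos[of k]
      by (simp add: error_at_def)
    moreover have "(\<lambda>\<omega>. error_at k u \<omega>) \<in> borel_measurable M"
      unfolding error_at_eq by measurable
    ultimately show ?thesis by (simp add: emb)
  qed
  from error_nn_integral_le[OF \<psi> this] show ?thesis
    by (simp add: emb)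
qed

section \<open>Expectation and tail bounds for the optimality gap\<close>

lemma expectation_opt_gap_bound:
  assumes C: "\<And>u. (\<integral>\<^sup>+\<omega>. ennreal ((norm (gradF u (Z \<omega>) - gradf u))\<^sup>2) \<partial>M) \<le> ennreal C" and C0: "0 \<le> C"
    and \<gamma>: "rate < \<gamma>" "\<And>k. 1 / real (m k) \<le> lam * \<gamma> ^ k"
  shows "integrable M (\<lambda>\<omega>. opt_gap h (x k \<omega>))"
    "0 \<le> expectation (\<lambda>\<omega>. opt_gap h (x k \<omega>))"
    "expectation (\<lambda>\<omega>. opt_gap h (x k \<omega>))
       \<le> rate ^ k * opt_gap h x0 + 2 / L * (C * lam / (\<gamma> - rate)) * \<gamma> ^ k"
proof -
  note ms = mean_square_error[OF C C0]
  define R where "R \<omega> = rate ^ k * opt_gap h x0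
    + 2 / L * (\<Sum>j<k. rate ^ (k - Suc j) * (norm (e j \<omega>))\<^sup>2)" for \<omega>
  have le: "opt_gap h (x k \<omega>) \<le> R \<omega>" if "\<omega> \<in> space M" for \<omega>
    unfolding R_def by (rule opt_gap_recurrence[OF that])
  have nonneg: "0 \<le> opt_gap h (x k \<omega>)" if "\<omega> \<in> space M" for \<omega>
    by (rule opt_gap_nonneg[OF x_dom[OF that]])
  have R: "integrable M R"
    unfolding R_def using ms(1) by (intro Bochner_Integration.integrable_add integrable_mult_right
      Bochner_Integration.integrable_sum) auto
  show int: "integrable M (\<lambda>\<omega>. opt_gap h (x k \<omega>))"
  proof (rule Bochner_Integration.integrable_bound[OF R opt_gap_measurable])
    show "AE \<omega> in M. norm (opt_gap h (x k \<omega>)) \<le> norm (R \<omega>)"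
      using le nonneg by (intro AE_I2) fastforce
  qed
  show "0 \<le> expectation (\<lambda>\<omega>. opt_gap h (x k \<omega>))"
    using nonneg by (intro integral_nonneg_AE AE_I2) auto
  have "expectation (\<lambda>\<omega>. opt_gap h (x k \<omega>)) \<le> expectation R"
    using le by (intro integral_mono int R)
  also have "\<dots> = rate ^ k * opt_gap h x0
      + 2 / L * (\<Sum>j<k. rate ^ (k - Suc j) * expectation (\<lambda>\<omega>. (norm (e j \<omega>))\<^sup>2))"
    unfolding R_def using ms(1)
    by (subst Bochner_Integration.integral_add)
      (auto simp: Bochner_Integration.integral_sum prob_space
        intro!: integrable_mult_right Bochner_Integration.integrable_sum)
  also have "\<dots> \<le> rate ^ k * opt_gap h x0 + 2 / L * (\<Sum>j<k. rate ^ (k - Suc j) * (C * lam * \<gamma> ^ j))"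
  proof -
    have "expectation (\<lambda>\<omega>. (norm (e j \<omega>))\<^sup>2) \<le> C * lam * \<gamma> ^ j" for j
      using ms(2)[of j] mult_left_mono[OF \<gamma>(2)[of j] C0] by simp
    then show ?thesis
      using L_pos rate_pos by (intro add_left_mono mult_left_mono sum_mono) auto
  qed
  also have "(\<Sum>j<k. rate ^ (k - Suc j) * (C * lam * \<gamma> ^ j)) = C * lam * (\<Sum>j<k. rate ^ (k - Suc j) * \<gamma> ^ j)"
    by (simp add: sum_distrib_left mult_ac)
  also have "rate ^ k * opt_gap h x0 + 2 / L * (C * lam * (\<Sum>j<k. rate ^ (k - Suc j) * \<gamma> ^ j))
      \<le> rate ^ k * opt_gap h x0 + 2 / L * (C * lam * (\<gamma> ^ k / (\<gamma> - rate)))"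
  proof -
    \<comment> \<open>Nonnegativity of \<open>lam\<close> follows from the sample size condition at
      step 0.\<close>
    have "0 \<le> lam * \<gamma> ^ 0" by (rule order_trans[OF _ \<gamma>(2)]) simp
    then show ?thesis
      using L_pos rate_pos C0 \<gamma>(1) geometric_convolution_le[of rate \<gamma> k]
      by (intro add_left_mono mult_left_mono) auto
  qed
  finally show "expectation (\<lambda>\<omega>. opt_gap h (x k \<omega>))
      \<le> rate ^ k * opt_gap h x0 + 2 / L * (C * lam / (\<gamma> - rate)) * \<gamma> ^ k"
    by simp
qed

lemma opt_gap_tail_bound:
  assumes D: "\<And>u z z' b. z \<in> space N \<Longrightarrow> z' \<in> space N \<Longrightarrow> b \<in> Basis \<Longrightarrow> \<bar>(gradF u z - gradF u z') \<bullet> b\<bar> \<le> D"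
    and D0: "0 < D" and lam: "0 < lam"
    and \<gamma>: "rate < \<gamma>" "\<And>k. 1 / real (m k) \<le> lam * \<gamma> ^ k"
  shows "\<exists>\<zeta>>0. \<exists>C. \<forall>k \<epsilon>. prob {\<omega> \<in> space M. \<epsilon> \<le> opt_gap h (x k \<omega>) - rate ^ k * opt_gap h x0}
    \<le> C * exp (- (\<epsilon> / \<gamma> ^ k) * \<zeta>)"
proof -
  \<comment> \<open>With \<open>rate = \<gamma> * s\<^sup>2\<close>, the share \<open>s ^ i\<close>
    divided by \<open>rate ^ i\<close> is \<open>1 / (\<gamma> * s) ^ i\<close>: beyond the scale of
    \<open>\<gamma>\<close> the thresholds still grow like \<open>(1 / s) ^ i\<close>, which makes
    the tails summable.\<close>
  define s where "s = sqrt (rate / \<gamma>)"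
  have \<gamma>0: "0 < \<gamma>" using rate_pos \<gamma>(1) by simp
  have s: "0 < s" "s < 1" and s2: "rate = \<gamma> * s\<^sup>2"
    using rate_pos \<gamma>(1) \<gamma>0 by (simp_all add: s_def real_sqrt_lt_1_iff)
  define A where "A = 2 * real DIM('a)"
  define c where "c = 2 / (real DIM('a) * D\<^sup>2)"
  have A: "A > 0" and c: "c > 0" using D0 by (simp_all add: A_def c_def)
  define \<zeta> where "\<zeta> = c / lam * (L / 2 * (1 - s)) * \<gamma>"
  have \<zeta>: "\<zeta> > 0" using c lam L_pos s \<gamma>0 by (simp add: \<zeta>_def)
  \<comment> \<open>The first summand carries the series of the main case; \<open>exp 1\<close>
    makes the claimed bound at least 1 when the exponent is below 1, which includes all levels
    \<open>\<epsilon> \<le> 0\<close>.\<close>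
  define K where "K = A / (1 - exp (- (1 / s - 1))) + exp 1"
  have "1 - exp (- (1 / s - 1)) > 0" using s by (simp add: field_simps)
  then have K: "K \<ge> exp 1" "K \<ge> A / (1 - exp (- (1 / s - 1)))"
    using A by (simp_all add: K_def)
  have "prob {\<omega> \<in> space M. \<epsilon> \<le> opt_gap h (x k \<omega>) - rate ^ k * opt_gap h x0} \<le> K * exp (- (\<epsilon> / \<gamma> ^ k) * \<zeta>)"
    (is "prob ?E \<le> _") for k \<epsilon>
  proof (cases "1 \<le> \<epsilon> / \<gamma> ^ k * \<zeta>")
    case False
    have "prob ?E \<le> exp 1 * exp (- 1)" by (simp flip: exp_add)
    also have "\<dots> \<le> K * exp (- (\<epsilon> / \<gamma> ^ k) * \<zeta>)"
      using K(1) False by (intro mult_mono) (auto intro: order_trans[OF exp_ge_zero K(1)])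
    finally show ?thesis .
  next
    case True
    define y where "y = \<epsilon> / \<gamma> ^ k * \<zeta>"
    have \<epsilon>: "0 < \<epsilon>"
    proof (rule ccontr)
      assume "\<not> 0 < \<epsilon>"
      then have "\<epsilon> / \<gamma> ^ k * \<zeta> \<le> 0"
        using \<gamma>0 \<zeta> by (intro mult_nonpos_nonneg divide_nonpos_pos) auto
      with True show False by simp
    qed
    define a where "a j = \<epsilon> * L / 2 * (1 - s) * s ^ (k - Suc j) / rate ^ (k - Suc j)" for j
    have a0: "0 \<le> a j" for j
      using \<epsilon> L_pos s rate_pos by (simp add: a_def)
    define E where "E j = {\<omega> \<in> space M. a j \<le> (norm (e j \<omega>))\<^sup>2}" for j
    have [measurable]: "E j \<in> events" for j unfolding E_def by measurable
    have "?E \<subseteq> (\<Union>j<k. E j)"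
    proof
      fix \<omega> assume "\<omega> \<in> ?E"
      then have \<omega>: "\<omega> \<in> space M" and "\<epsilon> \<le> 2 / L * (\<Sum>j<k. rate ^ (k - Suc j) * (norm (e j \<omega>))\<^sup>2)"
        using opt_gap_recurrence[of \<omega> k] by auto
      moreover have "\<epsilon> * L / 2 \<le> S" if "\<epsilon> \<le> 2 / L * S" for S
        using that L_pos by (simp add: field_simps)
      ultimately have "\<epsilon> * L / 2 \<le> (\<Sum>j<k. rate ^ (k - Suc j) * (norm (e j \<omega>))\<^sup>2)"
        by blast
      from geometric_sum_large_summand[OF _ s(2) _ this] s \<epsilon> L_pos
      obtain j where "j < k" "\<epsilon> * L / 2 * (1 - s) * s ^ (k - Suc j) \<le> rate ^ (k - Suc j) * (norm (e j \<omega>))\<^sup>2"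
        by auto
      then have "a j \<le> (norm (e j \<omega>))\<^sup>2"
        using rate_pos by (simp add: a_def field_simps)
      with \<omega> \<open>j < k\<close> show "\<omega> \<in> (\<Union>j<k. E j)"
        by (auto simp: E_def)
    qed
    then have "prob ?E \<le> prob (\<Union>j<k. E j)"
      by (intro finite_measure_mono) auto
    also have "\<dots> \<le> (\<Sum>j<k. prob (E j))"
      by (intro finite_measure_subadditive_finite) auto
    also have "\<dots> \<le> (\<Sum>j<k. A * exp (- y * (1 / s) ^ (k - Suc j)))"
    proof (rule sum_mono)
      fix j assume "j \<in> {..<k}"
      then have k: "k = Suc (j + (k - Suc j))" by auto
      have "prob (E j) \<le> A * exp (- c * (real (m j) * a j))"
        unfolding E_def A_def c_def by (rule error_tail[OF D D0 a0])
      also have "\<dots> \<le> A * exp (- y * (1 / s) ^ (k - Suc j))"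
      proof -
        \<comment> \<open>The sample size condition makes \<open>m j\<close> at least the reciprocal
          of \<open>lam * \<gamma> ^ j\<close>.\<close>
        have "1 \<le> real (m j) * (lam * \<gamma> ^ j)"
          using \<gamma>(2)[of j] m_pos[of j] by (simp add: field_simps)
        then have "1 * (a j / (lam * \<gamma> ^ j)) \<le> (real (m j) * (lam * \<gamma> ^ j)) * (a j / (lam * \<gamma> ^ j))"
          using a0 lam \<gamma>0 by (intro mult_right_mono) auto
        then have "a j / (lam * \<gamma> ^ j) \<le> real (m j) * a j"
          using lam \<gamma>0 by simp
        then have "c * (a j / (lam * \<gamma> ^ j)) \<le> c * (real (m j) * a j)"
          using c by (intro mult_left_mono) auto
        moreover have "c * (a j / (lam * \<gamma> ^ j)) = y * (1 / s) ^ (k - Suc j)"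
        proof -
          \<comment> \<open>Here \<open>i + j = k - 1\<close>; the factor \<open>\<gamma>\<close> in
            \<open>\<zeta>\<close> compensates the missing power.\<close>
          define i where "i = k - Suc j"
          have ki: "\<gamma> ^ k = \<gamma> * \<gamma> ^ j * \<gamma> ^ i"
            by (subst k) (simp add: i_def power_add)
          show ?thesis
            using s \<gamma>0 lam unfolding y_def \<zeta>_def a_def s2 i_def[symmetric] ki
            by (simp add: power_mult_distrib power2_eq_square field_simps power_one_over)
        qed
        ultimately show ?thesis using A by simp
      qed
      finally show "prob (E j) \<le> A * exp (- y * (1 / s) ^ (k - Suc j))" .
    qed
    also have "\<dots> = A * (\<Sum>i<k. exp (- y * (1 / s) ^ i))"
      unfolding sum_distrib_left[symmetric] using sum.nat_diff_reindex[of "\<lambda>i. exp (- y * (1 / s) ^ i)" k] by simp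
    also have "\<dots> \<le> A * (exp (- y) / (1 - exp (- (1 / s - 1))))"
      using A True s by (intro mult_left_mono sum_exp_growing_le) (auto simp: y_def)
    also have "\<dots> = A / (1 - exp (- (1 / s - 1))) * exp (- y)" by simp
    also have "\<dots> \<le> K * exp (- y)" using K(2) by (intro mult_right_mono) auto
    finally show ?thesis by (simp add: y_def)
  qed
  with \<zeta> show ?thesis by blast
qed

end

subsection \<open>Convergence\<close>

theorem theorem6p1:
  fixes f :: "real ^ 'n \<Rightarrow> real" and gradf :: "real ^ 'n \<Rightarrow> real ^ 'n"
    and g h :: "real ^ 'n \<Rightarrow> ereal"
    and L \<tau> \<rho> \<beta> lam :: real
    and M :: "'w measure" and N :: "'z measure"
    and Z :: "'w \<Rightarrow> 'z" and F :: "real ^ 'n \<Rightarrow> 'z \<Rightarrow> real"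
    and gradF :: "real ^ 'n \<Rightarrow> 'z \<Rightarrow> real ^ 'n"
    and m :: "nat \<Rightarrow> nat" and Zs :: "nat \<Rightarrow> nat \<Rightarrow> 'w \<Rightarrow> 'z"
    and x0 :: "real ^ 'n" and x e :: "nat \<Rightarrow> 'w \<Rightarrow> real ^ 'n"
  assumes gradf: "\<And>u. GDERIV f u :> gradf u"
    and g_proper: "\<And>u. g u \<noteq> -\<infinity>"
    and g_convex: "convex_ereal g"
    and g_lsc: "lower_semicont g"
    and h: "h = (\<lambda>u. ereal (f u) + g u)"
    and S_nonempty: "argmin_set h \<noteq> {}"
    and L_pos: "L > 0"
    and \<tau>_ge: "\<tau> \<ge> 1"
    and lipschitz: "\<And>u v. norm (gradf v - gradf u) \<le> L * norm (v - u)"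
    and error_bound: "\<And>u. infdist u (argmin_set h)
                         \<le> \<tau> * norm (u - prox g (1 / L) (u - (1 / L) *\<^sub>R gradf u))"
    and \<rho>: "\<rho> = 40 * \<tau>\<^sup>2 / (1 + 40 * \<tau>\<^sup>2)"
    \<comment> \<open>the random variable \<^term>\<open>Z\<close>, with sample space \<^term>\<open>space N\<close>\<close>
    and M: "prob_space M"
    and Z: "Z \<in> measurable M N"
    and F_measurable: "\<And>u. F u \<in> borel_measurable N"
    and F_integrable: "\<And>u. integrable M (\<lambda>\<omega>. F u (Z \<omega>))"
    and f_eq: "\<And>u. f u = (\<integral>\<omega>. F u (Z \<omega>) \<partial>M)"
    and gradF: "\<And>u z. z \<in> space N \<Longrightarrow> GDERIV (\<lambda>v. F v z) u :> gradF u z"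
    \<comment> \<open>\<^term>\<open>Zs k i\<close>, for \<^term>\<open>1 \<le> i\<close> and \<^term>\<open>i \<le> m k\<close>, is the sample drawn at iteration \<^term>\<open>k\<close>\<close>
    and Zs_indep: "prob_space.indep_vars M (\<lambda>_. N) (\<lambda>(k, i). Zs k i) (SIGMA k:UNIV. {1..m k})"
    and Zs_copies: "\<And>k i. i \<in> {1..m k} \<Longrightarrow> distr M N (Zs k i) = distr M N Z"
    and m_pos: "\<And>k. m k \<ge> 1"
    and \<beta>: "0 < \<beta>" "\<beta> < 1"
    and lam: "lam > 0"
    and m_rate: "\<And>k. 1 / real (m k) \<le> lam * \<beta> ^ k"
    \<comment> \<open>the algorithm, started at a point of the domain of \<^term>\<open>h\<close>\<close>
    and x0: "h x0 < \<infinity>"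
    and x_0: "\<And>\<omega>. \<omega> \<in> space M \<Longrightarrow> x 0 \<omega> = x0"
    and direction: "\<And>k \<omega>. \<omega> \<in> space M \<Longrightarrow>
        gradf (x k \<omega>) + e k \<omega> = (1 / real (m k)) *\<^sub>R (\<Sum>i=1..m k. gradF (x k \<omega>) (Zs k i \<omega>))"
    and x_Suc: "\<And>k \<omega>. \<omega> \<in> space M \<Longrightarrow>
        x (Suc k) \<omega> = prox g (1 / L) (x k \<omega> - (1 / L) *\<^sub>R (gradf (x k \<omega>) + e k \<omega>))"
  shows
    \<comment> \<open>the optimality gaps are finite random variables\<close>
    "(\<bar>INF y. h y\<bar> \<noteq> \<infinity>
      \<and> (\<forall>k. \<forall>\<omega>\<in>space M. \<bar>h (x k \<omega>)\<bar> \<noteq> \<infinity>)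
      \<and> (\<forall>k. (\<lambda>\<omega>. opt_gap h (x k \<omega>)) \<in> borel_measurable M))
     \<and>
     \<comment> \<open>expectation bound\<close>
     ((SUP u. \<integral>\<^sup>+\<omega>. ennreal ((norm (gradf u - gradF u (Z \<omega>)))\<^sup>2) \<partial>M) < \<infinity> \<longrightarrow>
        (\<forall>k. integrable M (\<lambda>\<omega>. opt_gap h (x k \<omega>)))
        \<and> (\<forall>\<zeta>>0. (\<lambda>k. (\<integral>\<omega>. opt_gap h (x k \<omega>) \<partial>M) - \<rho> ^ k * opt_gap h x0)
                     \<in> O(\<lambda>k. (max \<beta> \<rho> + \<zeta>) ^ k))
        \<and> (\<rho> \<noteq> \<beta> \<longrightarrow> (\<lambda>k. (\<integral>\<omega>. opt_gap h (x k \<omega>) \<partial>M) - \<rho> ^ k * opt_gap h x0)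
                     \<in> O(\<lambda>k. max \<beta> \<rho> ^ k)))
     \<and>
     \<comment> \<open>tail bound, with constants uniform in \<^term>\<open>k\<close> and \<open>\<epsilon>\<close>\<close>
     ((\<forall>i. (SUP u. (SUP z\<in>space N. ereal (gradF u z $ i)) - (INF z\<in>space N. ereal (gradF u z $ i)))
             < \<infinity>) \<longrightarrow>
        (\<exists>\<zeta>>0. \<exists>C. \<forall>k \<epsilon>.
           measure M {\<omega> \<in> space M. opt_gap h (x k \<omega>) - \<rho> ^ k * opt_gap h x0 \<ge> \<epsilon>}
             \<le> C * exp (- (\<epsilon> / max \<beta> \<rho> ^ k) * \<zeta>)))"
proof -
  interpret prob_space M by (rule M)
  interpret composite_problem f gradf g h L
    using gradf g_proper g_convex g_lsc h S_nonempty L_pos lipschitz x0 by unfold_locales auto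
  interpret sampled_prox_gradient f gradf g h L M \<tau> N Z F gradF m Zs x0 x e
    by unfold_locales (fact assms)+
  define \<gamma> where "\<gamma> = max \<beta> \<rho>"
  \<comment> \<open>Both are values of the increasing map c -> c \<tau>^2 / (1 + c \<tau>^2), at c =
    8 and c = 40.\<close>
  have rate_less: "rate < \<rho>"
  proof -
    have "0 < \<tau>\<^sup>2" using \<tau>_ge by simp
    then show ?thesis
      unfolding rate_def \<rho> by (simp add: divide_less_eq add_pos_pos field_simps)
  qed
  have \<gamma>: "rate < \<gamma>" "0 < \<gamma>" "\<beta> \<le> \<gamma>" "\<rho> \<le> \<gamma>"
    using rate_less \<beta>(1) by (auto simp: \<gamma>_def)
  have \<rho>0: "0 \<le> \<rho>" using rate_pos rate_less by simp
  have m_rate': "1 / real (m k) \<le> lam * \<gamma> ^ k" for k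
    using m_rate[of k] mult_left_mono[OF power_mono[OF \<gamma>(3), of k]] \<beta>(1) lam
    by (smt (verit, best))
  define \<pi>0 where "\<pi>0 = opt_gap h x0"
  have \<pi>0: "0 \<le> \<pi>0"
    unfolding \<pi>0_def by (rule opt_gap_nonneg[OF g_finite_if_h_finite[OF x0]])
  have rate_\<rho>: "rate ^ k * \<pi>0 \<le> \<rho> ^ k * \<pi>0" for k
    using rate_less rate_pos \<pi>0 by (intro mult_right_mono power_mono) auto
  have \<rho>_\<gamma>: "\<rho> ^ k * \<pi>0 \<le> \<pi>0 * \<gamma> ^ k" for k
    using \<gamma>(4) \<rho>0 \<pi>0 by (simp add: mult.commute mult_left_mono power_mono)

  have INF_fin: "\<bar>INF y. h y\<bar> \<noteq> \<infinity>"
    by (simp add: INF_h)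
  have h_fin: "\<bar>h (x k \<omega>)\<bar> \<noteq> \<infinity>" if "\<omega> \<in> space M" for k \<omega>
    using h_eq[OF x_dom[OF that]] by simp
  have expectation_bound: "(\<forall>k. integrable M (\<lambda>\<omega>. opt_gap h (x k \<omega>)))
      \<and> (\<forall>\<zeta>>0. (\<lambda>k. (\<integral>\<omega>. opt_gap h (x k \<omega>) \<partial>M) - \<rho> ^ k * \<pi>0) \<in> O(\<lambda>k. (\<gamma> + \<zeta>) ^ k))
      \<and> (\<lambda>k. (\<integral>\<omega>. opt_gap h (x k \<omega>) \<partial>M) - \<rho> ^ k * \<pi>0) \<in> O(\<lambda>k. \<gamma> ^ k)"
    if fin: "(SUP u. \<integral>\<^sup>+\<omega>. ennreal ((norm (gradf u - gradF u (Z \<omega>)))\<^sup>2) \<partial>M) < \<infinity>"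
  proof -
    define C where "C = enn2real (SUP u. \<integral>\<^sup>+\<omega>. ennreal ((norm (gradf u - gradF u (Z \<omega>)))\<^sup>2) \<partial>M)"
    have C: "(\<integral>\<^sup>+\<omega>. ennreal ((norm (gradF u (Z \<omega>) - gradf u))\<^sup>2) \<partial>M) \<le> ennreal C" for u
    proof -
      have "(\<integral>\<^sup>+\<omega>. ennreal ((norm (gradf u - gradF u (Z \<omega>)))\<^sup>2) \<partial>M)
          \<le> (SUP u. \<integral>\<^sup>+\<omega>. ennreal ((norm (gradf u - gradF u (Z \<omega>)))\<^sup>2) \<partial>M)"
        by (rule SUP_upper) simp
      also have "\<dots> = ennreal C"
        using fin by (simp add: C_def ennreal_enn2real)
      finally show ?thesis by (simp add: norm_minus_commute)
    qed
    have C0: "0 \<le> C" by (simp add: C_def)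
    note bound = expectation_opt_gap_bound[OF C C0 \<gamma>(1) m_rate']
    define K where "K = 2 / L * (C * lam / (\<gamma> - rate))"
    have K: "0 \<le> K"
      using C0 lam \<gamma>(1) L_pos by (simp add: K_def)
    \<comment> \<open>The lower estimate uses that the expected gap is nonnegative, so the
      difference is at least \<open>- (\<rho> ^ k * \<pi>0)\<close>.\<close>
    have main: "\<bar>(\<integral>\<omega>. opt_gap h (x k \<omega>) \<partial>M) - \<rho> ^ k * \<pi>0\<bar> \<le> (K + \<pi>0) * \<gamma> ^ k" for k
    proof -
      have "0 \<le> K * \<gamma> ^ k" "0 \<le> \<pi>0 * \<gamma> ^ k" using K \<pi>0 \<gamma>(2) by auto
      then show ?thesis
        using bound(2,3)[of k] rate_\<rho>[of k] \<rho>_\<gamma>[of k]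
        unfolding K_def[symmetric] \<pi>0_def[symmetric] by (simp add: abs_le_iff distrib_right)
    qed
    have "(\<lambda>k. (\<integral>\<omega>. opt_gap h (x k \<omega>) \<partial>M) - \<rho> ^ k * \<pi>0) \<in> O(\<lambda>k. \<gamma> ^ k)"
      using main \<gamma>(2) by (intro bigoI[of _ "K + \<pi>0"] always_eventually) simp
    moreover from this have "(\<lambda>k. (\<integral>\<omega>. opt_gap h (x k \<omega>) \<partial>M) - \<rho> ^ k * \<pi>0) \<in> O(\<lambda>k. (\<gamma> + \<zeta>) ^ k)" if "\<zeta> > 0" for \<zeta>
    proof (rule landau_o.big_trans)
      show "(\<lambda>k. \<gamma> ^ k) \<in> O(\<lambda>k. (\<gamma> + \<zeta>) ^ k)"
        using that \<gamma>(2) by (intro bigoI[of _ 1] always_eventually) (simp add: power_mono)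
    qed
    ultimately show ?thesis
      using bound(1) by simp
  qed
  have tail_bound: "\<exists>\<zeta>>0. \<exists>C. \<forall>k \<epsilon>.
      measure M {\<omega> \<in> space M. opt_gap h (x k \<omega>) - \<rho> ^ k * \<pi>0 \<ge> \<epsilon>} \<le> C * exp (- (\<epsilon> / \<gamma> ^ k) * \<zeta>)"
    if fin: "\<forall>i. (SUP u. (SUP z\<in>space N. ereal (gradF u z $ i)) - (INF z\<in>space N. ereal (gradF u z $ i))) < \<infinity>"
  proof -
    have "\<exists>d. \<forall>u. \<forall>z\<in>space N. \<forall>z'\<in>space N. gradF u z $ i - gradF u z' $ i \<le> d" for i
    proof -
      define S where "S = (SUP u. (SUP z\<in>space N. ereal (gradF u z $ i)) - (INF z\<in>space N. ereal (gradF u z $ i)))"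
      have "S < \<infinity>" using fin by (simp add: S_def)
      then obtain d where d: "S \<le> ereal d" by (cases S) auto
      have "gradF u z $ i - gradF u z' $ i \<le> d" if "z \<in> space N" "z' \<in> space N" for u z z'
      proof -
        have "ereal (gradF u z $ i) - ereal (gradF u z' $ i)
            \<le> (SUP z\<in>space N. ereal (gradF u z $ i)) - (INF z\<in>space N. ereal (gradF u z $ i))"
          using that by (intro ereal_minus_mono SUP_upper INF_lower)
        also have "\<dots> \<le> S" unfolding S_def by (rule SUP_upper) simp
        also note d
        finally show ?thesis by simp
      qed
      then show ?thesis by blast
    qed
    then obtain d where d: "\<And>i u z z'. z \<in> space N \<Longrightarrow> z' \<in> space N \<Longrightarrow> gradF u z $ i - gradF u z' $ i \<le> d i"
      by metis
    \<comment> \<open>A single constant for all coordinates; the added 1 makes it positive.\<close>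
    define D where "D = (\<Sum>i\<in>UNIV. \<bar>d i\<bar>) + 1"
    have "d i \<le> D" for i
      using member_le_sum[of i UNIV "\<lambda>i. \<bar>d i\<bar>"] by (simp add: D_def)
    with d have diff: "gradF u z $ i - gradF u z' $ i \<le> D" if "z \<in> space N" "z' \<in> space N" for i u z z'
      using that order_trans by blast
    have D: "\<bar>(gradF u z - gradF u z') \<bullet> b\<bar> \<le> D"
      if z: "z \<in> space N" "z' \<in> space N" and b: "b \<in> Basis" for u z z' b
    proof -
      obtain i where "b = axis i 1" using b by (auto simp: Basis_vec_def)
      then show ?thesis
        using diff[OF z, of u i] diff[OF z(2,1), of u i] by (simp add: inner_axis abs_le_iff)
    qed
    have "0 < D" by (simp add: D_def add_nonneg_pos sum_nonneg)
    from opt_gap_tail_bound[OF D this lam \<gamma>(1) m_rate']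
    obtain \<zeta> C where \<zeta>: "\<zeta> > 0" and tail: "\<And>k \<epsilon>.
        prob {\<omega> \<in> space M. \<epsilon> \<le> opt_gap h (x k \<omega>) - rate ^ k * \<pi>0} \<le> C * exp (- (\<epsilon> / \<gamma> ^ k) * \<zeta>)"
      unfolding \<pi>0_def by blast
    \<comment> \<open>Since \<open>rate ^ k * \<pi>0\<close> is at most
      \<open>\<rho> ^ k * \<pi>0\<close>, the event for \<open>\<rho>\<close> is contained in the
      one for \<open>rate\<close>.\<close>
    have "prob {\<omega> \<in> space M. opt_gap h (x k \<omega>) - \<rho> ^ k * \<pi>0 \<ge> \<epsilon>}
        \<le> prob {\<omega> \<in> space M. \<epsilon> \<le> opt_gap h (x k \<omega>) - rate ^ k * \<pi>0}" for k \<epsilon>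
    proof (rule finite_measure_mono)
      show "{\<omega> \<in> space M. opt_gap h (x k \<omega>) - \<rho> ^ k * \<pi>0 \<ge> \<epsilon>}
          \<subseteq> {\<omega> \<in> space M. \<epsilon> \<le> opt_gap h (x k \<omega>) - rate ^ k * \<pi>0}"
        using rate_\<rho>[of k] by auto
      have [measurable]: "(\<lambda>\<omega>. opt_gap h (x k \<omega>)) \<in> borel_measurable M"
        by (rule opt_gap_measurable)
      show "{\<omega> \<in> space M. \<epsilon> \<le> opt_gap h (x k \<omega>) - rate ^ k * \<pi>0} \<in> events"
        by measurable
    qed
    with \<zeta> tail show ?thesis by (meson order_trans)
  qed
  show ?thesis
    unfolding \<gamma>_def[symmetric] \<pi>0_def[symmetric]
  proof (intro conjI)
    show "\<bar>INF y. h y\<bar> \<noteq> \<infinity>" by (rule INF_fin)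
    show "\<forall>k. \<forall>\<omega>\<in>space M. \<bar>h (x k \<omega>)\<bar> \<noteq> \<infinity>" by (intro allI ballI h_fin)
    show "\<forall>k. (\<lambda>\<omega>. opt_gap h (x k \<omega>)) \<in> borel_measurable M" using opt_gap_measurable by blast
  qed (use expectation_bound in blast, use tail_bound in blast)
qed

end
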